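(* Let $s\in(0,\infty)$, $r\in\mathbb N$ with $r>s$, $f\in\Lambda_s$, and assume the regularity $L$ of the Daubechies wavelet system satisfies $L\ge r-1$. Then there exist constants $c\in(0,1)$, $m\in\mathbb N$ and $R\in(1,\infty)$, independent of $f$ and $j$, such that for any $\varepsilon\in(0,\infty)$ and $j\in\mathbb Z_+$, $$T_j(s,f,\varepsilon)\subset\bigcup_{i=j+1}^{j+m}\big[S_{r,i}(s,f,c\varepsilon)\big]_R.$$
   Context: $\Delta_hf(x):=f(x+h/2)-f(x-h/2)$, $\Delta^{k+1}_h:=\Delta^k_h\Delta_h$, $\Delta_rf(x,y):=\sup_{|h|=y}|\Delta_h^rf(x)|$. $\Lambda_s$: bounded continuous $f$ with $\|f\|_{L^\infty}+\sup_{x,\,y\in(0,1]}\Delta_{\lfloor s\rfloor+1}f(x,y)/y^s<\infty$. $S_{r,i}(s,f,\varepsilon):=\{(x,y)\in\mathbb R^n\times(0,\infty):\Delta_rf(x,y)/y^s>\varepsilon,\ y\in(2^{-i-1},2^{-i}]\}$. $\mathcal D_j=\{2^{-j}(k+[0,1)^n):k\in\mathbb Z^n\}$; $\ell(I)$ side length; $T(I):=I\times(\ell(I)/2,\ell(I)]$. Daubechies wavelet system of regularity $L$ ($\varphi,\psi_\ell\in C^L_c$, $\ell=1,\dots,2^n-1$, vanishing moments up to order $L$, orthonormal basis of $L^2$ together with integer translates of $\varphi$); for $I=2^{-j}(k+[0,1)^n)$, $\psi_{(\ell,I)}:=2^{jn/2}\psi_\ell(2^j\cdot-k)$. $W_j(s,f,\varepsilon):=\{I\in\mathcal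 D_j:\max_{1\le\ell<2^n}|\int f\psi_{(\ell,I)}|>\varepsilon|I|^{s/n+1/2}\}$ and $T_j(s,f,\varepsilon):=\bigcup_{I\in W_j(s,f,\varepsilon)}T(I)$. Hyperbolic metric $\rho(\mathbf x,\mathbf y)=\operatorname{arccosh}(1+\frac{|\mathbf x-\mathbf y|^2}{2x_{n+1}y_{n+1}})$ on $\mathbb R^n\times(0,\infty)$; $A_R:=\{\mathbf x:\inf_{\mathbf y\in A}\rho(\mathbf x,\mathbf y)<R\}$. *)

theory Defs
  imports "HOL-Analysis.Analysis"
begin

fun Ck :: "nat \<Rightarrow> (real^'n \<Rightarrow> real) \<Rightarrow> bool" where
  "Ck 0 f = continuous_on UNIV f"
| "Ck (Suc k) f = (continuous_on UNIV f \<and>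
     (\<exists>D :: 'n \<Rightarrow> real^'n \<Rightarrow> real.
        (\<forall>i x. ((\<lambda>t. f (x + t *\<^sub>R axis i 1)) has_real_derivative D i x) (at 0))
        \<and> (\<forall>i. Ck k (D i))))"

definition compact_supp :: "(real^'n \<Rightarrow> real) \<Rightarrow> bool" where
  "compact_supp g \<longleftrightarrow> compact (closure {x. g x \<noteq> 0})"

definition monom :: "('n::finite \<Rightarrow> nat) \<Rightarrow> real^'n \<Rightarrow> real" where
  "monom \<alpha> x = (\<Prod>i\<in>UNIV. (x $ i) ^ (\<alpha> i))"

definition dcube :: "int \<Rightarrow> ('n::finite \<Rightarrow> int) \<Rightarrow> (real^'n) set" where
  "dcube j k = {x. \<forall>i. 2 powr (- real_of_int j) * of_int (k i) \<le> x $ i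
                   \<and> x $ i < 2 powr (- real_of_int j) * (of_int (k i) + 1)}"

definition dyadic :: "int \<Rightarrow> ((real^'n::finite) set) set" where
  "dyadic j = {dcube j k | k. True}"

definition wav :: "(real^'n::finite \<Rightarrow> real) \<Rightarrow> int \<Rightarrow> ('n \<Rightarrow> int) \<Rightarrow> real^'n \<Rightarrow> real" where
  "wav g j k x = 2 powr (real_of_int j * real CARD('n) / 2)
                 * g (2 powr (real_of_int j) *\<^sub>R x - (\<chi> i. of_int (k i)))"

definition L2inner :: "(real^'n::finite \<Rightarrow> real) \<Rightarrow> (real^'n \<Rightarrow> real) \<Rightarrow> real" where
  "L2inner g h = (LINT x|lborel. g x * h x)"

definition square_integrable :: "(real^'n::finite \<Rightarrow> real) \<Rightarrow> bool" where
  "square_integrable g \<longleftrightarrow> g \<in> borel_measurable lborel \<and> integrable lborel (\<lambda>x. (g x)^2)"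

text \<open>Daubechies wavelet system of regularity L. The system is indexed (to express
  orthonormality, distinct indices must give orthogonal functions):
  index Inl k  \<mapsto> phi(. - k);  index Inr (l,j,k) \<mapsto> psi_(l, 2^-j(k+[0,1)^n)).\<close>
definition wav_elem :: "(real^'n::finite \<Rightarrow> real) \<Rightarrow> (nat \<Rightarrow> real^'n \<Rightarrow> real)
     \<Rightarrow> ('n \<Rightarrow> int) + (nat \<times> nat \<times> ('n \<Rightarrow> int)) \<Rightarrow> real^'n \<Rightarrow> real" where
  "wav_elem \<phi> \<psi> idx = (case idx of Inl k \<Rightarrow> wav \<phi> 0 k
                        | Inr (l, j, k) \<Rightarrow> wav (\<psi> l) (int j) k)"

definition wav_index :: "('n::finite \<Rightarrow> int) + (nat \<times> nat \<times> ('n \<Rightarrow> int)) \<Rightarrow> bool" where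
  "wav_index idx = (case idx of Inl k \<Rightarrow> True
                    | Inr (l, j, k) \<Rightarrow> 1 \<le> l \<and> l < 2 ^ CARD('n))"

definition daubechies :: "nat \<Rightarrow> (real^'n::finite \<Rightarrow> real) \<Rightarrow> (nat \<Rightarrow> real^'n \<Rightarrow> real) \<Rightarrow> bool" where
  "daubechies L \<phi> \<psi> \<longleftrightarrow>
     Ck L \<phi> \<and> compact_supp \<phi> \<and>
     (\<forall>l. 1 \<le> l \<and> l < 2 ^ CARD('n) \<longrightarrow> Ck L (\<psi> l) \<and> compact_supp (\<psi> l) \<and>
         (\<forall>\<alpha>::'n \<Rightarrow> nat. (\<Sum>i\<in>UNIV. \<alpha> i) \<le> L \<longrightarrow>
             (LINT x|lborel. monom \<alpha> x * \<psi> l x) = 0)) \<and>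
     (\<forall>a b. wav_index a \<longrightarrow> wav_index b \<longrightarrow>
         L2inner (wav_elem \<phi> \<psi> a) (wav_elem \<phi> \<psi> b) = (if a = b then 1 else 0)) \<and>
     (\<forall>g. square_integrable g \<longrightarrow>
         (\<forall>a. wav_index a \<longrightarrow> L2inner g (wav_elem \<phi> \<psi> a) = 0) \<longrightarrow>
         (AE x in lborel. g x = 0))"

definition Delta1 :: "real^'n \<Rightarrow> (real^'n \<Rightarrow> real) \<Rightarrow> real^'n \<Rightarrow> real" where
  "Delta1 h f x = f (x + (1/2) *\<^sub>R h) - f (x - (1/2) *\<^sub>R h)"

fun DeltaPow :: "nat \<Rightarrow> real^'n \<Rightarrow> (real^'n \<Rightarrow> real) \<Rightarrow> real^'n \<Rightarrow> real" where
  "DeltaPow 0 h f = f"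
| "DeltaPow (Suc k) h f = DeltaPow k h (Delta1 h f)"

definition DeltaR :: "nat \<Rightarrow> (real^'n \<Rightarrow> real) \<Rightarrow> real^'n \<Rightarrow> real \<Rightarrow> real" where
  "DeltaR r f x y = (SUP h\<in>{h. norm h = y}. \<bar>DeltaPow r h f x\<bar>)"

definition Lambda :: "real \<Rightarrow> (real^'n \<Rightarrow> real) set" where
  "Lambda s = {f. continuous_on UNIV f \<and> bounded (range f) \<and>
      (\<exists>C. \<forall>x y. 0 < y \<and> y \<le> 1 \<longrightarrow> DeltaR (nat \<lfloor>s\<rfloor> + 1) f x y / y powr s \<le> C)}"

definition S_set :: "nat \<Rightarrow> int \<Rightarrow> real \<Rightarrow> (real^'n \<Rightarrow> real) \<Rightarrow> real \<Rightarrow> ((real^'n) \<times> real) set" where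
  "S_set r i s f \<epsilon> = {(x, y). 0 < y \<and> DeltaR r f x y / y powr s > \<epsilon>
        \<and> 2 powr (- real_of_int i - 1) < y \<and> y \<le> 2 powr (- real_of_int i)}"

definition Tbox :: "int \<Rightarrow> ('n::finite \<Rightarrow> int) \<Rightarrow> ((real^'n) \<times> real) set" where
  "Tbox j k = dcube j k \<times> {2 powr (- real_of_int j) / 2 <.. 2 powr (- real_of_int j)}"

definition W_set :: "int \<Rightarrow> real \<Rightarrow> (nat \<Rightarrow> real^'n \<Rightarrow> real) \<Rightarrow> (real^'n::finite \<Rightarrow> real) \<Rightarrow> real
     \<Rightarrow> ('n \<Rightarrow> int) set" where
  "W_set j s \<psi> f \<epsilon> = {k. (MAX l\<in>{1..<2 ^ CARD('n)}.
        \<bar>LINT x|lborel. f x * wav (\<psi> l) j k x\<bar>)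
      > \<epsilon> * (measure lborel (dcube j k :: (real^'n) set)) powr (s / real CARD('n) + 1/2)}"

definition T_set :: "int \<Rightarrow> real \<Rightarrow> (nat \<Rightarrow> real^'n \<Rightarrow> real) \<Rightarrow> (real^'n::finite \<Rightarrow> real) \<Rightarrow> real
     \<Rightarrow> ((real^'n) \<times> real) set" where
  "T_set j s \<psi> f \<epsilon> = (\<Union>k\<in>W_set j s \<psi> f \<epsilon>. Tbox j k)"

definition hyp_dist :: "((real^'n) \<times> real) \<Rightarrow> ((real^'n) \<times> real) \<Rightarrow> real" where
  "hyp_dist p q = arcosh (1 + ((norm (fst p - fst q))^2 + (snd p - snd q)^2)
                              / (2 * snd p * snd q))"

definition hyp_nbhd :: "((real^'n) \<times> real) set \<Rightarrow> real \<Rightarrow> ((real^'n) \<times> real) set" where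
  "hyp_nbhd A R = {p. 0 < snd p \<and> (\<exists>q\<in>A. hyp_dist p q < R)}"

end

theory Submission
  imports Defs "HOL-Computational_Algebra.Polynomial"
begin

text \<open>After rescaling the cube to unit size, a wavelet coefficient becomes \<open>\<integral> g \<psi>\<close> with \<open>\<psi>\<close>
  compactly supported and orthogonal to polynomials of degree below \<open>r\<close>. A Whitney type
  inequality bounds the distance of \<open>g\<close> to such polynomials on a ball by the size \<open>M\<close> of the
  differences \<open>\<Delta>\<^sub>h\<^sup>r g\<close> with \<open>\<eta> \<le> |h| \<le> 2 r \<eta>\<close> on a larger ball, hence also the coefficient by a
  multiple of \<open>M\<close>. With \<open>2 r \<eta> = 1/2\<close>, a large coefficient therefore forces a large difference at
  a comparable smaller scale and a nearby location, i.e. at bounded hyperbolic distance.\<close>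

subsection \<open>Forward differences\<close>

primrec forward_diff :: "nat \<Rightarrow> ('a::plus \<Rightarrow> 'b::minus) \<Rightarrow> 'a \<Rightarrow> 'a \<Rightarrow> 'b" where
  "forward_diff 0 f h x = f x"
| "forward_diff (Suc r) f h x = forward_diff r f h (x + h) - forward_diff r f h x"

lemma forward_diff_Suc':
  "forward_diff (Suc r) f h x = forward_diff r (\<lambda>x. f (x + h) - f x) h x"
  by (induction r arbitrary: x) auto

lemma forward_diff_add:
  fixes f g :: "'a::plus \<Rightarrow> 'b::ab_group_add"
  shows "forward_diff r (\<lambda>x. f x + g x) h x = forward_diff r f h x + forward_diff r g h x"
  by (induction r arbitrary: x) auto

lemma forward_diff_sum:
  fixes f :: "'c \<Rightarrow> 'a::plus \<Rightarrow> 'b::ab_group_add"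
  shows "forward_diff r (\<lambda>x. \<Sum>k\<in>A. f k x) h x = (\<Sum>k\<in>A. forward_diff r (f k) h x)"
  by (induction r arbitrary: x) (auto simp: sum_subtractf)

lemma forward_diff_cmult:
  fixes f :: "'a::plus \<Rightarrow> 'b::ring"
  shows "forward_diff r (\<lambda>x. c * f x) h x = c * forward_diff r f h x"
  by (induction r arbitrary: x) (auto simp: algebra_simps)

lemma forward_diff_linear_comp:
  assumes "linear T"
  shows "forward_diff r (\<lambda>x. f (p + T x)) h x = forward_diff r f (T h) (p + T x)"
  by (induction r arbitrary: x) (auto simp: linear_add[OF assms] add.assoc)

lemma forward_diff_affine_comp:
  fixes f :: "real \<Rightarrow> 'b::minus"
  shows "forward_diff r (\<lambda>t. f (p + k * t)) h x = forward_diff r f (k * h) (p + k * x)"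
  by (rule forward_diff_linear_comp) (simp add: linear_iff algebra_simps)

lemma forward_diff_eq_sum:
  fixes f :: "'a::real_vector \<Rightarrow> 'b::comm_ring_1"
  shows "forward_diff r f h x
    = (\<Sum>k\<le>r. (-1) ^ (r + k) * of_nat (r choose k) * f (x + real k *\<^sub>R h))"
proof (induction r arbitrary: x)
  case (Suc r)
  let ?G = "\<lambda>k. f (x + real k *\<^sub>R h)"
  have at_x: "- forward_diff r f h x = (-1) ^ Suc r * ?G 0
      + (\<Sum>k\<le>r. (-1) ^ (r + k) * of_nat (r choose Suc k) * ?G (Suc k))"
  proof -
    have "- forward_diff r f h x
        = (\<Sum>k\<le>Suc r. (-1) ^ (Suc r + k) * of_nat (r choose k) * ?G k)"
      by (simp add: Suc.IH sum_negf binomial_eq_0)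
    then show ?thesis
      by (subst (asm) sum.atMost_Suc_shift) (simp add: binomial_eq_0)
  qed
  have at_x_h: "forward_diff r f h (x + h)
      = (\<Sum>k\<le>r. (-1) ^ (r + k) * of_nat (r choose k) * ?G (Suc k))"
    by (simp add: Suc.IH algebra_simps)
  have "forward_diff (Suc r) f h x = (-1) ^ Suc r * ?G 0
      + (\<Sum>k\<le>r. (-1) ^ (r + k) * of_nat (Suc r choose Suc k) * ?G (Suc k))"
    unfolding forward_diff.simps diff_conv_add_uminus at_x at_x_h
    by (simp add: sum.distrib distrib_left distrib_right)
  also have "\<dots> = (\<Sum>k\<le>Suc r. (-1) ^ (Suc r + k) * of_nat (Suc r choose k) * ?G k)"
    by (subst sum.atMost_Suc_shift) simp
  finally show ?case .
qed simp

lemma forward_diff_eq_base_plus_sum: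
  fixes f :: "'a::real_vector \<Rightarrow> 'b::comm_ring_1"
  shows "(-1) ^ r * forward_diff r f h x
    = f x + (\<Sum>k=1..r. (-1) ^ k * of_nat (r choose k) * f (x + real k *\<^sub>R h))"
proof -
  have "(-1) ^ r * forward_diff r f h x
      = (\<Sum>k\<le>r. (-1) ^ k * of_nat (r choose k) * f (x + real k *\<^sub>R h))"
    by (simp add: forward_diff_eq_sum sum_distrib_left power_add mult.assoc)
  also have "{..r} = insert 0 {1..r}" by auto
  finally show ?thesis by simp
qed

lemma norm_forward_diff_le:
  fixes f :: "'a::plus \<Rightarrow> 'b::real_normed_vector"
  assumes "\<And>x. norm (f x) \<le> B"
  shows "norm (forward_diff r f h x) \<le> 2 ^ r * B"
proof (induction r arbitrary: x)
  case (Suc r)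
  show ?case
    using norm_triangle_ineq4[of "forward_diff r f h (x + h)" "forward_diff r f h x"]
      Suc.IH[of x] Suc.IH[of "x + h"] by simp
qed (use assms in simp)

lemma forward_diff_has_real_derivative:
  assumes "\<And>t. (F has_real_derivative F' t) (at t)"
  shows "((\<lambda>t. forward_diff r F h (t + c)) has_real_derivative forward_diff r F' h (t + c)) (at t)"
proof (induction r arbitrary: c)
  case 0
  show ?case using assms[of "t + c"] by (simp add: DERIV_shift)
next
  case (Suc r)
  show ?case
    using DERIV_diff[OF Suc.IH[of "c + h"] Suc.IH[of c]] by (simp add: add.assoc)
qed

lemma forward_diff_mean_value:
  fixes D :: "nat \<Rightarrow> real \<Rightarrow> real"
  assumes "\<And>i t. i < r \<Longrightarrow> (D i has_real_derivative D (Suc i) t) (at t)" and "0 < \<eta>"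
  shows "\<exists>\<xi>. a \<le> \<xi> \<and> \<xi> \<le> a + real r * \<eta> \<and> forward_diff r (D 0) \<eta> a = \<eta> ^ r * D r \<xi>"
  using assms(1)
proof (induction r arbitrary: D)
  case (Suc r)
  define E where "E = (\<lambda>i t. D i (t + \<eta>) - D i t)"
  have "(E i has_real_derivative E (Suc i) t) (at t)" if "i < r" for i t
    unfolding E_def using that
    by (intro DERIV_diff DERIV_shift[THEN iffD1, of "D i"] Suc.prems) auto
  from Suc.IH[of E, OF this] obtain \<xi>
    where \<xi>: "a \<le> \<xi>" "\<xi> \<le> a + real r * \<eta>" "forward_diff r (E 0) \<eta> a = \<eta> ^ r * E r \<xi>"
    by blast
  obtain \<zeta> where \<zeta>: "\<xi> < \<zeta>" "\<zeta> < \<xi> + \<eta>" "E r \<xi> = \<eta> * D (Suc r) \<zeta>"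
    using MVT2[of \<xi> "\<xi> + \<eta>" "D r" "D (Suc r)"] Suc.prems \<open>0 < \<eta>\<close> by (auto simp: E_def)
  have "forward_diff (Suc r) (D 0) \<eta> a = \<eta> ^ Suc r * D (Suc r) \<zeta>"
    using \<xi>(3) \<zeta>(3) by (simp add: E_def forward_diff_Suc' del: forward_diff.simps)
  moreover have "a \<le> \<zeta>" "\<zeta> \<le> a + real (Suc r) * \<eta>"
    using \<zeta> \<xi> by (auto simp: algebra_simps)
  ultimately show ?case by blast
qed auto

lemma power_over_fact_has_real_derivative:
  assumes "i < r"
  shows "((\<lambda>t::real. t ^ (r - i) / fact (r - i)) has_real_derivative
    t ^ (r - Suc i) / fact (r - Suc i)) (at t)"
proof -
  obtain d where "r - i = Suc d" "r - Suc i = d"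
    using Suc_diff_Suc[OF assms] by metis
  then show ?thesis
    by (auto intro!: derivative_eq_intros simp: field_simps simp del: power_Suc of_nat_Suc)
qed

lemma forward_diff_power_over_fact:
  assumes "0 < (\<eta>::real)"
  shows "forward_diff r (\<lambda>t. t ^ r / fact r) \<eta> a = \<eta> ^ r"
  using forward_diff_mean_value[where r = r and a = a and
      D = "\<lambda>i t. t ^ (r - i) / fact (r - i)", OF power_over_fact_has_real_derivative assms]
  by auto

definition diff_bounded ::
    "nat \<Rightarrow> real \<Rightarrow> real \<Rightarrow> ('a::real_normed_vector \<Rightarrow> real) \<Rightarrow> real \<Rightarrow> bool" where
  "diff_bounded r \<eta> \<rho> f M \<longleftrightarrow> (\<forall>x h. norm x \<le> \<rho> \<longrightarrow> \<eta> \<le> norm h \<longrightarrow> norm h \<le> 2 * real r * \<eta> \<longrightarrow>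
     \<bar>forward_diff r f h x\<bar> \<le> M)"

lemma diff_bounded_nonneg:
  fixes f :: "'a::{real_normed_vector, perfect_space} \<Rightarrow> real"
  assumes "diff_bounded r \<eta> \<rho> f M" and "1 \<le> r" "0 \<le> \<eta>" "0 \<le> \<rho>"
  shows "0 \<le> M"
proof -
  obtain h :: 'a where "norm h = \<eta>"
    using vector_choose_size[OF \<open>0 \<le> \<eta>\<close>] by blast
  moreover have "\<eta> \<le> 2 * real r * \<eta>"
    using assms by (simp add: mult_le_cancel_right1)
  ultimately have "\<bar>forward_diff r f h 0\<bar> \<le> M"
    using assms unfolding diff_bounded_def by simp
  then show ?thesis by linarith
qed

lemma diff_bounded_line:
  assumes "diff_bounded r \<eta> \<rho> f M" and "norm u = 1" and "norm p + b \<le> \<rho>"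
  shows "diff_bounded r \<eta> b (\<lambda>t. f (p + t *\<^sub>R u)) M"
  unfolding diff_bounded_def
proof (intro allI impI)
  fix x h :: real
  assume "norm x \<le> b" "\<eta> \<le> norm h" "norm h \<le> 2 * real r * \<eta>"
  moreover have "norm (p + x *\<^sub>R u) \<le> norm p + norm x"
    using norm_triangle_ineq[of p "x *\<^sub>R u"] assms(2) by simp
  ultimately have "\<bar>forward_diff r f (h *\<^sub>R u) (p + x *\<^sub>R u)\<bar> \<le> M"
    using assms unfolding diff_bounded_def by simp
  moreover have "forward_diff r (\<lambda>t. f (p + t *\<^sub>R u)) h x
      = forward_diff r f (h *\<^sub>R u) (p + x *\<^sub>R u)"
    by (rule forward_diff_linear_comp) (simp add: linear_iff scaleR_add_left)
  ultimately show "\<bar>forward_diff r (\<lambda>t. f (p + t *\<^sub>R u)) h x\<bar> \<le> M"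
    by simp
qed

subsection \<open>Whitney's inequality on the line\<close>

lemma continuous_antiderivative:
  fixes f :: "real \<Rightarrow> real"
  assumes "continuous_on UNIV f"
  shows "\<exists>F. \<forall>x. (F has_real_derivative f x) (at x)"
proof -
  have "\<exists>F. \<forall>x :: real. (-\<infinity>::ereal) < ereal x \<longrightarrow> ereal x < \<infinity>
      \<longrightarrow> (F has_vector_derivative f x) (at x)"
    using assms by (intro einterval_antiderivative) (auto simp: continuous_on_eq_continuous_at)
  then show ?thesis
    by (auto simp: has_real_derivative_iff_has_vector_derivative)
qed

lemma iterated_antiderivative:
  fixes g :: "real \<Rightarrow> real"
  assumes "continuous_on UNIV g"
  shows "\<exists>F. F r = g \<and> (\<forall>i<r. \<forall>t. (F i has_real_derivative F (Suc i) t) (at t))"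
  using assms
proof (induction r arbitrary: g)
  case (Suc r)
  obtain G where G: "\<And>t. (G has_real_derivative g t) (at t)"
    using continuous_antiderivative[OF Suc.prems] by blast
  then have "continuous_on UNIV G"
    by (meson DERIV_isCont continuous_at_imp_continuous_on)
  from Suc.IH[OF this] obtain F
    where F: "F r = G" "\<And>i t. i < r \<Longrightarrow> (F i has_real_derivative F (Suc i) t) (at t)"
    by blast
  show ?case
    using F G by (intro exI[of _ "F(Suc r := g)"]) (auto simp: less_Suc_eq)
qed auto

definition spline_weight :: "nat \<Rightarrow> nat \<Rightarrow> real" where
  "spline_weight r k = (-1) ^ k * real (r choose k) / real k ^ r"

text \<open>If \<open>F\<close> is an \<open>r\<close>-fold antiderivative of \<open>g\<close>, each summand is, up to its sign and
  binomial factor, the average of \<open>g (x + k h)\<close> over \<open>h\<close> against a B-spline supported in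
  \<open>[r \<eta>, 2 r \<eta>]\<close>. So the sum is the average of \<open>g x - (-1)\<^sup>r \<Delta>\<^sub>h\<^sup>r g x\<close>.\<close>
definition spline_average :: "nat \<Rightarrow> real \<Rightarrow> (real \<Rightarrow> real) \<Rightarrow> real \<Rightarrow> real" where
  "spline_average r \<eta> F x = - (\<Sum>k=1..r. spline_weight r k *
     forward_diff r F (real k * \<eta>) (x + real k * (real r * \<eta>))) / \<eta> ^ r"

lemma spline_average_has_real_derivative:
  assumes "\<And>t. (F has_real_derivative F' t) (at t)"
  shows "(spline_average r \<eta> F has_real_derivative spline_average r \<eta> F' t) (at t)"
  unfolding spline_average_def
  by (intro DERIV_cdivide DERIV_minus DERIV_sum DERIV_cmult forward_diff_has_real_derivative assms)

lemma spline_average_error: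
  fixes F :: "nat \<Rightarrow> real \<Rightarrow> real"
  assumes F: "\<And>i t. i < r \<Longrightarrow> (F i has_real_derivative F (Suc i) t) (at t)" and "0 < \<eta>"
  shows "\<exists>\<xi>. real r * \<eta> \<le> \<xi> \<and> \<xi> \<le> 2 * real r * \<eta> \<and>
    \<bar>F r x - spline_average r \<eta> (F 0) x\<bar> = \<bar>forward_diff r (F r) \<xi> x\<bar>"
proof -
  define D where "D = (\<lambda>i t. F r x * (t ^ (r - i) / fact (r - i)) +
     (\<Sum>k=1..r. (spline_weight r k * real k ^ i) * F i (x + real k * t)))"
  have "(D i has_real_derivative D (Suc i) t) (at t)" if i: "i < r" for i t
  proof -
    have "((\<lambda>t. F i (x + real k * t)) has_real_derivative
        F (Suc i) (x + real k * t) * real k) (at t)" for k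
      by (rule DERIV_chain2[OF F[OF i]]) (auto intro!: derivative_eq_intros)
    then have "(D i has_real_derivative F r x * (t ^ (r - Suc i) / fact (r - Suc i)) +
       (\<Sum>k=1..r. (spline_weight r k * real k ^ i) * (F (Suc i) (x + real k * t) * real k))) (at t)"
      unfolding D_def
      by (intro DERIV_add DERIV_sum DERIV_cmult power_over_fact_has_real_derivative[OF i])
    then show ?thesis
      by (simp add: D_def mult_ac)
  qed
  from forward_diff_mean_value[of r D \<eta> "real r * \<eta>", OF this \<open>0 < \<eta>\<close>] obtain \<xi>
    where \<xi>: "real r * \<eta> \<le> \<xi>" "\<xi> \<le> real r * \<eta> + real r * \<eta>"
      "forward_diff r (D 0) \<eta> (real r * \<eta>) = \<eta> ^ r * D r \<xi>"
    by blast
  have "(\<Sum>k=1..r. (spline_weight r k * real k ^ r) * F r (x + real k * \<xi>))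
      = (\<Sum>k=1..r. (-1) ^ k * real (r choose k) * F r (x + real k * \<xi>))"
    by (intro sum.cong) (auto simp: spline_weight_def)
  then have D_r: "D r \<xi> = (-1) ^ r * forward_diff r (F r) \<xi> x"
    using forward_diff_eq_base_plus_sum[of r "F r" \<xi> x] by (simp add: D_def)
  have "\<eta> ^ r * spline_average r \<eta> (F 0) x = - (\<Sum>k=1..r. spline_weight r k *
      forward_diff r (F 0) (real k * \<eta>) (x + real k * (real r * \<eta>)))"
    using \<open>0 < \<eta>\<close> by (simp add: spline_average_def)
  then have "\<eta> ^ r * (F r x - spline_average r \<eta> (F 0) x)
      = forward_diff r (D 0) \<eta> (real r * \<eta>)"
    using \<open>0 < \<eta>\<close>
    by (simp add: D_def forward_diff_add forward_diff_sum forward_diff_cmult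
        forward_diff_affine_comp forward_diff_power_over_fact[simplified] right_diff_distrib
        mult.commute[of _ "F r x"] del: times_divide_eq_right)
  also note \<xi>(3)
  finally have "\<bar>F r x - spline_average r \<eta> (F 0) x\<bar> = \<bar>forward_diff r (F r) \<xi> x\<bar>"
    using \<open>0 < \<eta>\<close> by (simp add: D_r abs_mult power_abs)
  with \<xi> show ?thesis by (intro exI[of _ \<xi>]) (auto simp: mult_ac)
qed

lemma diff_bounded_at_spline_node:
  assumes "diff_bounded r \<eta> (b + (real r)\<^sup>2 * \<eta>) g M" and "0 < \<eta>" "\<bar>x\<bar> \<le> b" and k: "k \<in> {1..r}"
  shows "\<bar>forward_diff r g (real k * \<eta>) (x + real k * (real r * \<eta>))\<bar> \<le> M"
proof -
  have "real k * (real r * \<eta>) \<le> real r * (real r * \<eta>)"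
    using k \<open>0 < \<eta>\<close> by (intro mult_right_mono) auto
  moreover have "\<bar>x + real k * (real r * \<eta>)\<bar> \<le> \<bar>x\<bar> + real k * (real r * \<eta>)"
    using \<open>0 < \<eta>\<close> abs_triangle_ineq[of x "real k * (real r * \<eta>)"] by (simp add: abs_mult)
  ultimately have "\<bar>x + real k * (real r * \<eta>)\<bar> \<le> b + (real r)\<^sup>2 * \<eta>"
    using \<open>\<bar>x\<bar> \<le> b\<close> by (simp add: power2_eq_square mult.assoc)
  moreover have "\<eta> \<le> real k * \<eta>" "real k * \<eta> \<le> 2 * real r * \<eta>"
    using k \<open>0 < \<eta>\<close> by auto
  ultimately show ?thesis
    using assms(1) \<open>0 < \<eta>\<close> unfolding diff_bounded_def by simp
qed

lemma abs_spline_average_le: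
  assumes bounded: "diff_bounded r \<eta> (b + (real r)\<^sup>2 * \<eta>) g M"
    and "1 \<le> r" and \<eta>: "0 < \<eta>" and x: "\<bar>x\<bar> \<le> b"
  shows "\<bar>spline_average r \<eta> g x\<bar> \<le> (2 / \<eta>) ^ r * M"
proof -
  have "0 \<le> M"
    using diff_bounded_nonneg[OF bounded \<open>1 \<le> r\<close>] \<eta> x by simp
  let ?term = "\<lambda>k. spline_weight r k *
     forward_diff r g (real k * \<eta>) (x + real k * (real r * \<eta>))"
  have "\<bar>?term k\<bar> \<le> real (r choose k) * M" if k: "k \<in> {1..r}" for k
  proof -
    have "\<bar>spline_weight r k\<bar> \<le> real (r choose k)"
      using k by (auto simp: spline_weight_def abs_mult power_abs field_simps mult_le_cancel_left1)
    then show ?thesis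
      unfolding abs_mult by (intro mult_mono diff_bounded_at_spline_node[OF bounded \<eta> x k]) auto
  qed
  then have "\<bar>\<Sum>k=1..r. ?term k\<bar> \<le> (\<Sum>k=1..r. real (r choose k) * M)"
    by (intro order_trans[OF sum_abs] sum_mono)
  also have "\<dots> \<le> (\<Sum>k\<le>r. real (r choose k) * M)"
    using \<open>0 \<le> M\<close> by (intro sum_mono2) auto
  also have "\<dots> = 2 ^ r * M"
    using choose_row_sum[of r] by (simp flip: sum_distrib_right of_nat_sum)
  finally show ?thesis
    using \<eta> by (simp add: spline_average_def power_abs power_divide divide_right_mono)
qed

lemma Maclaurin_polynomial_error:
  fixes G :: "nat \<Rightarrow> real \<Rightarrow> real"
  assumes G: "\<And>i t. i < r \<Longrightarrow> (G i has_real_derivative G (Suc i) t) (at t)"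
    and top_derivative: "\<And>t. \<bar>t\<bar> \<le> b \<Longrightarrow> \<bar>G r t\<bar> \<le> K" and "1 \<le> r"
  shows "\<exists>Q. degree Q < r \<and> (\<forall>t. \<bar>t\<bar> \<le> b \<longrightarrow> \<bar>G 0 t - poly Q t\<bar> \<le> b ^ r * K)"
proof -
  define Q where "Q = (\<Sum>i<r. Polynomial.monom (G i 0 / fact i) i)"
  have "\<bar>G 0 t - poly Q t\<bar> \<le> b ^ r * K" if t: "\<bar>t\<bar> \<le> b" for t
  proof -
    obtain u where u: "\<bar>u\<bar> \<le> \<bar>t\<bar>"
      "G 0 t = (\<Sum>m<r. G m 0 / fact m * t ^ m) + G r u / fact r * t ^ r"
      using Maclaurin_bi_le[of G "G 0" r t] G by auto
    then have "\<bar>G 0 t - poly Q t\<bar> = \<bar>t\<bar> ^ r * (\<bar>G r u\<bar> / fact r)"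
      by (simp add: Q_def poly_sum poly_monom abs_mult power_abs)
    also have "\<dots> \<le> b ^ r * (K / 1)"
      using u(1) t top_derivative[of u]
      by (intro mult_mono frac_le power_mono) (auto simp: fact_ge_1)
    finally show ?thesis by simp
  qed
  moreover have "degree Q < r"
    unfolding Q_def using \<open>1 \<le> r\<close>
    by (intro degree_sum_less) (auto intro: le_less_trans[OF degree_monom_le])
  ultimately show ?thesis by blast
qed

definition whitney_const :: "nat \<Rightarrow> real \<Rightarrow> real \<Rightarrow> real" where
  "whitney_const r \<eta> b = 1 + (2 * b / \<eta>) ^ r"

lemma whitney_real:
  fixes g :: "real \<Rightarrow> real"
  assumes g: "continuous_on UNIV g" and r: "1 \<le> r" and \<eta>: "0 < \<eta>" and "0 \<le> b"
    and bounded: "diff_bounded r \<eta> (b + (real r)\<^sup>2 * \<eta>) g M"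
  shows "\<exists>Q. degree Q < r \<and> (\<forall>t. \<bar>t\<bar> \<le> b \<longrightarrow> \<bar>g t - poly Q t\<bar> \<le> whitney_const r \<eta> b * M)"
proof -
  obtain F where F: "F r = g" "\<And>i t. i < r \<Longrightarrow> (F i has_real_derivative F (Suc i) t) (at t)"
    using iterated_antiderivative[OF g, of r] by blast
  have approx: "\<bar>g t - spline_average r \<eta> (F 0) t\<bar> \<le> M" if "\<bar>t\<bar> \<le> b" for t
  proof -
    obtain \<xi> where \<xi>: "real r * \<eta> \<le> \<xi>" "\<xi> \<le> 2 * real r * \<eta>"
      "\<bar>g t - spline_average r \<eta> (F 0) t\<bar> = \<bar>forward_diff r g \<xi> t\<bar>"
      using spline_average_error[of r F \<eta> t, OF F(2) \<eta>] F(1) by auto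
    have "\<eta> \<le> real r * \<eta>"
      using r \<eta> by simp
    then have "\<eta> \<le> \<xi>"
      using \<xi>(1) by linarith
    moreover have "\<bar>t\<bar> \<le> b + (real r)\<^sup>2 * \<eta>"
      using that \<eta> by (simp add: add_increasing2)
    ultimately show ?thesis
      using bounded \<eta> \<xi> unfolding diff_bounded_def by simp
  qed
  have top_derivative: "\<bar>spline_average r \<eta> (F r) t\<bar> \<le> (2 / \<eta>) ^ r * M" if "\<bar>t\<bar> \<le> b" for t
    unfolding F(1) by (rule abs_spline_average_le[OF bounded r \<eta> that])
  obtain Q where Q: "degree Q < r"
      "\<And>t. \<bar>t\<bar> \<le> b \<Longrightarrow> \<bar>spline_average r \<eta> (F 0) t - poly Q t\<bar> \<le> b ^ r * ((2 / \<eta>) ^ r * M)"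
    using Maclaurin_polynomial_error[of r "\<lambda>i. spline_average r \<eta> (F i)" b, OF _ top_derivative r]
      spline_average_has_real_derivative F(2) by blast
  have "\<bar>g t - poly Q t\<bar> \<le> whitney_const r \<eta> b * M" if "\<bar>t\<bar> \<le> b" for t
    using approx[OF that] Q(2)[OF that]
    by (simp add: whitney_const_def algebra_simps power_mult_distrib power_divide)
  with Q(1) show ?thesis by blast
qed

subsection \<open>Lagrange interpolation\<close>

definition lagrange_basis :: "'a::field set \<Rightarrow> 'a \<Rightarrow> 'a poly" where
  "lagrange_basis S a = (\<Prod>c\<in>S - {a}. smult (inverse (a - c)) [:- c, 1:])"

lemma poly_lagrange_basis:
  assumes "finite S" "a \<in> S" "c \<in> S"
  shows "poly (lagrange_basis S a) c = (if c = a then 1 else 0)"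
proof (cases "c = a")
  case True
  have "poly (smult (inverse (a - d)) [:- d, 1:]) a = 1" if "d \<in> S - {a}" for d
    using that left_inverse[of "a - d"] by (auto simp: algebra_simps)
  with True show ?thesis
    unfolding lagrange_basis_def poly_prod by (simp del: poly_smult)
next
  case False
  with assms show ?thesis
    by (auto simp: lagrange_basis_def poly_prod)
qed

lemma degree_lagrange_basis_less:
  assumes "finite S" "a \<in> S"
  shows "degree (lagrange_basis S a) < card S"
proof -
  have "degree (lagrange_basis S a) \<le> (\<Sum>c\<in>S - {a}. 1)"
    unfolding lagrange_basis_def using assms
    by (intro order_trans[OF degree_prod_sum_le] sum_mono)
      (auto intro!: order_trans[OF degree_smult_le] simp: degree_pCons_le)
  also have "\<dots> < card S"
    using assms by (cases "card S") auto
  finally show ?thesis .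
qed

lemma lagrange_interpolation:
  assumes "degree p < card S"
  shows "p = (\<Sum>a\<in>S. smult (poly p a) (lagrange_basis S a))" (is "_ = ?q")
proof (rule poly_eqI_degree[of S])
  have S: "finite S" "0 < card S"
    using assms by (auto intro: card_ge_0_finite)
  then show "degree ?q < card S"
    by (auto intro!: degree_sum_less le_less_trans[OF degree_smult_le] degree_lagrange_basis_less)
  fix c assume "c \<in> S"
  with S show "poly p c = poly ?q c"
    by (simp add: poly_sum poly_lagrange_basis if_distrib cong: if_cong)
qed (fact assms)

lemma abs_coeff_le_lagrange:
  fixes p :: "real poly"
  assumes "degree p < card S" "\<And>a. a \<in> S \<Longrightarrow> \<bar>poly p a\<bar> \<le> K"
  shows "\<bar>coeff p d\<bar> \<le> (\<Sum>a\<in>S. \<bar>coeff (lagrange_basis S a) d\<bar>) * K"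
proof -
  have "coeff p d = (\<Sum>a\<in>S. poly p a * coeff (lagrange_basis S a) d)"
    by (subst lagrange_interpolation[OF assms(1)]) (simp add: coeff_sum)
  also have "\<bar>\<dots>\<bar> \<le> (\<Sum>a\<in>S. K * \<bar>coeff (lagrange_basis S a) d\<bar>)"
    using assms(2) by (intro order_trans[OF sum_abs] sum_mono)
      (auto simp: abs_mult intro!: mult_right_mono)
  finally show ?thesis
    by (simp add: sum_distrib_left mult.commute)
qed

lemma lebesgue_function_bounded:
  "\<exists>B\<ge>0. \<forall>t. \<bar>t\<bar> \<le> b \<longrightarrow> (\<Sum>a\<in>S. \<bar>poly (lagrange_basis S a) t\<bar>) \<le> B" for b :: real
proof -
  obtain B where "B \<ge> 0"
    "\<And>t. t \<in> {-b..b} \<Longrightarrow> norm (\<Sum>a\<in>S. \<bar>poly (lagrange_basis S a) t\<bar>) \<le> B"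
    by (rule continuous_on_compact_bound[of "{-b..b}" "\<lambda>t. \<Sum>a\<in>S. \<bar>poly (lagrange_basis S a) t\<bar>"])
      (auto intro!: continuous_intros)
  then show ?thesis
    by (intro exI[of _ B]) (auto simp: abs_le_iff)
qed

lemma lagrange_interpolation_error_le:
  fixes g :: "real \<Rightarrow> real"
  assumes "S \<subseteq> {-b..b}" "degree Q < card S"
    and near: "\<And>t. \<bar>t\<bar> \<le> b \<Longrightarrow> \<bar>g t - poly Q t\<bar> \<le> K" and t: "\<bar>t\<bar> \<le> b"
    and lebesgue: "(\<Sum>a\<in>S. \<bar>poly (lagrange_basis S a) t\<bar>) \<le> B"
  shows "\<bar>g t - (\<Sum>a\<in>S. poly (lagrange_basis S a) t * g a)\<bar> \<le> (1 + B) * K"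
proof -
  have "poly Q t = (\<Sum>a\<in>S. poly (lagrange_basis S a) t * poly Q a)"
    by (subst lagrange_interpolation[OF assms(2)]) (simp add: poly_sum mult.commute)
  then have "g t - (\<Sum>a\<in>S. poly (lagrange_basis S a) t * g a)
     = (g t - poly Q t) - (\<Sum>a\<in>S. poly (lagrange_basis S a) t * (g a - poly Q a))"
    by (simp add: right_diff_distrib sum_subtractf)
  moreover have "\<bar>\<Sum>a\<in>S. poly (lagrange_basis S a) t * (g a - poly Q a)\<bar>
      \<le> (\<Sum>a\<in>S. \<bar>poly (lagrange_basis S a) t\<bar> * K)"
    using assms(1) by (intro order_trans[OF sum_abs] sum_mono)
      (force simp: abs_mult abs_le_iff intro!: mult_left_mono near)
  moreover have "0 \<le> K"
    using near[OF t] by linarith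
  then have "(\<Sum>a\<in>S. \<bar>poly (lagrange_basis S a) t\<bar> * K) \<le> B * K"
    unfolding sum_distrib_right[symmetric] by (intro mult_right_mono lebesgue)
  ultimately show ?thesis
    using near[OF t] by (simp add: algebra_simps)
qed

subsection \<open>Tensor product interpolation\<close>

definition coord_upd :: "'n::finite \<Rightarrow> real \<Rightarrow> real^'n \<Rightarrow> real^'n" where
  "coord_upd i t x = (\<chi> j. if j = i then t else x $ j)"

lemma coord_upd_nth: "coord_upd i t x $ j = (if j = i then t else x $ j)"
  by (simp add: coord_upd_def)

lemma coord_upd_same: "coord_upd i (x $ i) x = x"
  by (simp add: vec_eq_iff coord_upd_nth)

lemma coord_upd_eq_line: "coord_upd i t x = coord_upd i 0 x + t *\<^sub>R axis i 1"
  by (simp add: vec_eq_iff coord_upd_nth axis_def)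

definition tensor_interpolant ::
    "real set \<Rightarrow> 'n::finite set \<Rightarrow> (real^'n \<Rightarrow> real) \<Rightarrow> real^'n \<Rightarrow> real" where
  "tensor_interpolant S A f x = (\<Sum>k\<in>PiE A (\<lambda>_. S).
     (\<Prod>i\<in>A. poly (lagrange_basis S (k i)) (x $ i)) * f (\<chi> i. if i \<in> A then k i else x $ i))"

lemma tensor_interpolant_empty: "tensor_interpolant S {} f x = f x"
  by (simp add: tensor_interpolant_def)

lemma tensor_interpolant_insert:
  fixes A :: "'n::finite set"
  assumes "i \<notin> A"
  shows "tensor_interpolant S (insert i A) f x
    = (\<Sum>a\<in>S. poly (lagrange_basis S a) (x $ i) * tensor_interpolant S A f (coord_upd i a x))"
proof -
  let ?P = "PiE A (\<lambda>_. S)"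
  define summand where "summand k = (\<Prod>j\<in>insert i A. poly (lagrange_basis S (k j)) (x $ j)) *
      f (\<chi> j. if j \<in> insert i A then k j else x $ j)" for k :: "'n \<Rightarrow> real"
  have summand_upd: "summand (k(i := a)) = poly (lagrange_basis S a) (x $ i) *
      ((\<Prod>j\<in>A. poly (lagrange_basis S (k j)) (coord_upd i a x $ j)) *
        f (\<chi> j. if j \<in> A then k j else coord_upd i a x $ j))" for a k
  proof -
    have "(\<Prod>j\<in>A. poly (lagrange_basis S ((k(i := a)) j)) (x $ j))
        = (\<Prod>j\<in>A. poly (lagrange_basis S (k j)) (coord_upd i a x $ j))"
      using assms by (intro prod.cong) (auto simp: coord_upd_nth)
    moreover have "(\<chi> j. if j \<in> insert i A then (k(i := a)) j else x $ j)
        = (\<chi> j. if j \<in> A then k j else coord_upd i a x $ j)"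
      using assms by (auto simp: vec_eq_iff coord_upd_nth)
    ultimately show ?thesis
      using assms unfolding summand_def by (subst prod.insert) auto
  qed
  have "tensor_interpolant S (insert i A) f x = (\<Sum>(a, k)\<in>S \<times> ?P. summand (k(i := a)))"
    unfolding tensor_interpolant_def PiE_insert_eq summand_def[symmetric]
    using inj_combinator[OF assms, of "\<lambda>_. S"]
    by (subst sum.reindex) (simp_all add: case_prod_unfold)
  also have "\<dots> = (\<Sum>a\<in>S. \<Sum>k\<in>?P. summand (k(i := a)))"
    by (rule sum.cartesian_product[symmetric])
  finally show ?thesis
    by (simp add: summand_upd tensor_interpolant_def sum_distrib_left)
qed

lemma tensor_interpolant_error_le:
  fixes f :: "real^'n::finite \<Rightarrow> real"
  assumes S: "S \<subseteq> {-b..b}" and "0 \<le> B"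
    and lebesgue: "\<And>t. \<bar>t\<bar> \<le> b \<Longrightarrow> (\<Sum>a\<in>S. \<bar>poly (lagrange_basis S a) t\<bar>) \<le> B"
    and coord_error: "\<And>x i. (\<And>j. \<bar>x $ j\<bar> \<le> b) \<Longrightarrow>
      \<bar>f x - (\<Sum>a\<in>S. poly (lagrange_basis S a) (x $ i) * f (coord_upd i a x))\<bar> \<le> K"
    and "\<And>j. \<bar>x $ j\<bar> \<le> b"
  shows "\<bar>f x - tensor_interpolant S A f x\<bar> \<le> (\<Sum>m<card A. B ^ m) * K"
  using finite[of A] assms(5)
proof (induction A arbitrary: x rule: finite_induct)
  case empty
  then show ?case by (simp add: tensor_interpolant_empty)
next
  case (insert i A)
  let ?E = "(\<Sum>m<card A. B ^ m) * K"
  let ?l = "\<lambda>a. poly (lagrange_basis S a) (x $ i)"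
  have "\<bar>f (coord_upd i a x) - tensor_interpolant S A f (coord_upd i a x)\<bar> \<le> ?E" if "a \<in> S" for a
    using that S insert.prems by (intro insert.IH) (auto simp: coord_upd_nth abs_le_iff)
  then have "\<bar>\<Sum>a\<in>S. ?l a * (f (coord_upd i a x) - tensor_interpolant S A f (coord_upd i a x))\<bar>
      \<le> (\<Sum>a\<in>S. \<bar>?l a\<bar> * ?E)"
    by (intro order_trans[OF sum_abs] sum_mono) (auto simp: abs_mult intro!: mult_left_mono)
  moreover have "0 \<le> K"
    using coord_error[OF insert.prems, of i] by linarith
  then have "0 \<le> ?E"
    using \<open>0 \<le> B\<close> by (intro mult_nonneg_nonneg sum_nonneg) auto
  then have "(\<Sum>a\<in>S. \<bar>?l a\<bar> * ?E) \<le> B * ?E"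
    unfolding sum_distrib_right[symmetric] by (intro mult_right_mono lebesgue insert.prems)
  moreover have "f x - tensor_interpolant S (insert i A) f x
      = (f x - (\<Sum>a\<in>S. ?l a * f (coord_upd i a x)))
        + (\<Sum>a\<in>S. ?l a * (f (coord_upd i a x) - tensor_interpolant S A f (coord_upd i a x)))"
    using insert.hyps by (simp add: tensor_interpolant_insert right_diff_distrib sum_subtractf)
  moreover have "\<bar>f x - (\<Sum>a\<in>S. ?l a * f (coord_upd i a x))\<bar> \<le> K"
    by (intro coord_error insert.prems)
  ultimately have "\<bar>f x - tensor_interpolant S (insert i A) f x\<bar> \<le> K + B * ?E"
    by linarith
  also have "\<dots> = (\<Sum>m<card (insert i A). B ^ m) * K"
    using insert.hyps
    by (simp add: sum.lessThan_Suc_shift sum_distrib_left algebra_simps del: sum.lessThan_Suc)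
  finally show ?case .
qed

subsection \<open>Polynomials in several variables\<close>

lemma monom_scaleR: "Defs.monom \<beta> (t *\<^sub>R x) = t ^ sum \<beta> UNIV * Defs.monom \<beta> x"
  by (simp add: Defs.monom_def power_mult_distrib prod.distrib power_sum)

lemma finite_multi_indices: "finite {\<beta>::'n::finite \<Rightarrow> nat. sum \<beta> UNIV < N}"
proof (rule finite_subset)
  have "\<beta> i \<le> sum \<beta> UNIV" for \<beta> :: "'n \<Rightarrow> nat" and i
    by (rule member_le_sum) auto
  then show "{\<beta>::'n \<Rightarrow> nat. sum \<beta> UNIV < N} \<subseteq> PiE UNIV (\<lambda>_. {..<N})"
    by (auto intro: le_less_trans)
qed (auto intro: finite_PiE)

definition multi_poly :: "nat \<Rightarrow> (('n::finite \<Rightarrow> nat) \<Rightarrow> real) \<Rightarrow> real^'n \<Rightarrow> real" where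
  "multi_poly N c x = (\<Sum>\<beta> | sum \<beta> UNIV < N. c \<beta> * Defs.monom \<beta> x)"

definition homogeneous_part :: "(('n::finite \<Rightarrow> nat) \<Rightarrow> real) \<Rightarrow> nat \<Rightarrow> real^'n \<Rightarrow> real" where
  "homogeneous_part c d x = (\<Sum>\<beta> | sum \<beta> UNIV = d. c \<beta> * Defs.monom \<beta> x)"

lemma homogeneous_part_scaleR: "homogeneous_part c d (t *\<^sub>R x) = t ^ d * homogeneous_part c d x"
  by (simp add: homogeneous_part_def monom_scaleR sum_distrib_left mult_ac)

lemma multi_poly_eq_sum_homogeneous_part: "multi_poly N c x = (\<Sum>d<N. homogeneous_part c d x)"
proof -
  have "(\<Sum>d<N. homogeneous_part c d x)
      = (\<Sum>d<N. \<Sum>\<beta> | \<beta> \<in> {\<beta>. sum \<beta> UNIV < N} \<and> sum \<beta> UNIV = d. c \<beta> * Defs.monom \<beta> x)"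
    unfolding homogeneous_part_def by (intro sum.cong) auto
  also have "\<dots> = multi_poly N c x"
    unfolding multi_poly_def by (intro sum.group finite_multi_indices) auto
  finally show ?thesis ..
qed

lemma multi_poly_scaleR:
  "multi_poly N c (t *\<^sub>R x) = poly (\<Sum>d<N. Polynomial.monom (homogeneous_part c d x) d) t"
  by (simp add: multi_poly_eq_sum_homogeneous_part homogeneous_part_scaleR poly_sum poly_monom
      mult.commute)

lemma multi_poly_diff_eq_sum_homogeneous_part:
  assumes "r \<le> N"
  shows "multi_poly N c x - multi_poly r c x = (\<Sum>d=r..<N. homogeneous_part c d x)"
  using assms sum.atLeastLessThan_concat[of 0 r N "\<lambda>d. homogeneous_part c d x"]
  by (simp add: multi_poly_eq_sum_homogeneous_part lessThan_atLeast0)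

lemma abs_homogeneous_part_le:
  fixes x :: "real^'n::finite"
  assumes unit: "\<And>u. norm u = 1 \<Longrightarrow> \<bar>homogeneous_part c d u\<bar> \<le> K" and "norm x \<le> b"
  shows "\<bar>homogeneous_part c d x\<bar> \<le> b ^ d * K"
proof -
  obtain u where u: "norm u = 1" "x = norm x *\<^sub>R u"
  proof (cases "x = 0")
    case True
    moreover obtain u :: "real^'n" where "norm u = 1"
      using vector_choose_size[of 1] by auto
    ultimately show ?thesis using that by simp
  next
    case False
    with that[of "x /\<^sub>R norm x"] show ?thesis by simp
  qed
  have "\<bar>homogeneous_part c d x\<bar> = norm x ^ d * \<bar>homogeneous_part c d u\<bar>"
    by (subst u(2)) (simp add: homogeneous_part_scaleR abs_mult)
  also have "\<dots> \<le> b ^ d * K"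
    using assms u(1) order_trans[OF norm_ge_zero \<open>norm x \<le> b\<close>]
    by (intro mult_mono power_mono) auto
  finally show ?thesis .
qed

lemma abs_homogeneous_part_le_lagrange:
  assumes "degree Q < r" "r \<le> d" "d < card S"
    and near: "\<And>a. a \<in> S \<Longrightarrow> \<bar>multi_poly (card S) c (a *\<^sub>R u) - poly Q a\<bar> \<le> K"
  shows "\<bar>homogeneous_part c d u\<bar> \<le> (\<Sum>a\<in>S. \<bar>coeff (lagrange_basis S a) d\<bar>) * K"
proof -
  define p where "p = (\<Sum>d<card S. Polynomial.monom (homogeneous_part c d u) d) - Q"
  have "coeff p d = homogeneous_part c d u"
    using assms by (simp add: p_def coeff_sum coeff_eq_0)
  moreover have "degree p < card S"
    unfolding p_def using assms
    by (intro degree_diff_less degree_sum_less) (auto intro: le_less_trans[OF degree_monom_le])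
  then have "\<bar>coeff p d\<bar> \<le> (\<Sum>a\<in>S. \<bar>coeff (lagrange_basis S a) d\<bar>) * K"
    using near by (intro abs_coeff_le_lagrange) (simp_all add: p_def multi_poly_scaleR)
  ultimately show ?thesis by simp
qed

lemma multi_poly_truncation_error:
  fixes f :: "real^'n::finite \<Rightarrow> real"
  assumes S: "S \<subseteq> {-b..b}" "r \<le> card S"
    and approx: "\<And>x. norm x \<le> b \<Longrightarrow> \<bar>f x - multi_poly (card S) c x\<bar> \<le> K"
    and lines: "\<And>u. norm u = 1 \<Longrightarrow>
      \<exists>Q. degree Q < r \<and> (\<forall>t. \<bar>t\<bar> \<le> b \<longrightarrow> \<bar>f (t *\<^sub>R u) - poly Q t\<bar> \<le> L)"
    and x: "norm x \<le> b"
  shows "\<bar>f x - multi_poly r c x\<bar>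
    \<le> K + (\<Sum>d=r..<card S. b ^ d * (\<Sum>a\<in>S. \<bar>coeff (lagrange_basis S a) d\<bar>)) * (K + L)"
proof -
  define H where "H d = (\<Sum>a\<in>S. \<bar>coeff (lagrange_basis S a) d\<bar>)" for d
  have unit: "\<bar>homogeneous_part c d u\<bar> \<le> H d * (K + L)"
    if u: "norm u = 1" and d: "r \<le> d" "d < card S" for u d
  proof -
    obtain Q where Q: "degree Q < r" "\<And>t. \<bar>t\<bar> \<le> b \<Longrightarrow> \<bar>f (t *\<^sub>R u) - poly Q t\<bar> \<le> L"
      using lines[OF u] by blast
    have "\<bar>multi_poly (card S) c (a *\<^sub>R u) - poly Q a\<bar> \<le> K + L" if "a \<in> S" for a
    proof -
      have "\<bar>a\<bar> \<le> b" using S(1) that by (force simp: abs_le_iff)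
      then show ?thesis using Q(2)[of a] approx[of "a *\<^sub>R u"] u by simp
    qed
    then show ?thesis
      unfolding H_def using Q(1) d by (intro abs_homogeneous_part_le_lagrange)
  qed
  have "\<bar>multi_poly (card S) c x - multi_poly r c x\<bar> \<le> (\<Sum>d=r..<card S. b ^ d * (H d * (K + L)))"
    unfolding multi_poly_diff_eq_sum_homogeneous_part[OF S(2)]
    using unit x by (intro order_trans[OF sum_abs] sum_mono abs_homogeneous_part_le) auto
  also have "\<dots> = (\<Sum>d=r..<card S. b ^ d * H d) * (K + L)"
    by (simp add: sum_distrib_right mult.assoc)
  finally show ?thesis
    using approx[OF x] by (simp add: H_def)
qed

lemma prod_poly_eq_multi_poly:
  fixes p :: "'n::finite \<Rightarrow> real poly" and x :: "real^'n"
  assumes "\<And>i. degree (p i) < r"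
  shows "(\<Prod>i\<in>UNIV. poly (p i) (x $ i))
    = multi_poly (CARD('n) * r) (\<lambda>\<beta>. \<Prod>i\<in>UNIV. coeff (p i) (\<beta> i)) x"
proof -
  let ?c = "\<lambda>\<beta>. \<Prod>i\<in>UNIV. coeff (p i) (\<beta> i)"
  have "poly (p i) t = (\<Sum>d<r. coeff (p i) d * t ^ d)" for i t
    unfolding poly_altdef using assms[of i]
    by (intro sum.mono_neutral_left) (auto simp: coeff_eq_0)
  then have "(\<Prod>i\<in>UNIV. poly (p i) (x $ i)) = (\<Sum>\<beta>\<in>PiE UNIV (\<lambda>_. {..<r}). ?c \<beta> * Defs.monom \<beta> x)"
    by (simp add: prod_sum_PiE prod.distrib Defs.monom_def)
  also have "\<dots> = multi_poly (CARD('n) * r) ?c x"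
    unfolding multi_poly_def
  proof (rule sum.mono_neutral_left[OF finite_multi_indices])
    show "PiE UNIV (\<lambda>_. {..<r}) \<subseteq> {\<beta>::'n \<Rightarrow> nat. sum \<beta> UNIV < CARD('n) * r}"
    proof safe
      fix \<beta> :: "'n \<Rightarrow> nat" assume "\<beta> \<in> PiE UNIV (\<lambda>_. {..<r})"
      then have "sum \<beta> UNIV < (\<Sum>i\<in>(UNIV::'n set). r)"
        by (intro sum_strict_mono) (auto simp: PiE_iff)
      then show "sum \<beta> UNIV < CARD('n) * r" by simp
    qed
    show "\<forall>\<beta>\<in>{\<beta>. sum \<beta> UNIV < CARD('n) * r} - PiE UNIV (\<lambda>_. {..<r}). ?c \<beta> * Defs.monom \<beta> x = 0"
    proof
      fix \<beta> :: "'n \<Rightarrow> nat" assume "\<beta> \<in> {\<beta>. sum \<beta> UNIV < CARD('n) * r} - PiE UNIV (\<lambda>_. {..<r})"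
      then obtain i where "r \<le> \<beta> i" by (auto simp: PiE_iff not_less)
      then have "coeff (p i) (\<beta> i) = 0"
        using assms[of i] by (intro coeff_eq_0) simp
      then show "?c \<beta> * Defs.monom \<beta> x = 0" by (auto intro: bexI[of _ i])
    qed
  qed
  finally show ?thesis .
qed

lemma tensor_interpolant_UNIV_eq_multi_poly:
  fixes f :: "real^'n::finite \<Rightarrow> real"
  assumes "finite S"
  shows "\<exists>c. \<forall>x. tensor_interpolant S UNIV f x = multi_poly (CARD('n) * card S) c x"
proof -
  let ?P = "PiE (UNIV :: 'n set) (\<lambda>_. S)"
  define q where "q k \<beta> = (\<Prod>i\<in>UNIV. coeff (lagrange_basis S (k i)) (\<beta> i))" for k and \<beta> :: "'n \<Rightarrow> nat"
  have "(\<Prod>i\<in>UNIV. poly (lagrange_basis S (k i)) (x $ i)) = multi_poly (CARD('n) * card S) (q k) x"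
    if "k \<in> ?P" for k and x :: "real^'n"
    unfolding q_def using that assms
    by (intro prod_poly_eq_multi_poly degree_lagrange_basis_less) (auto simp: PiE_iff)
  then have "tensor_interpolant S UNIV f x
      = (\<Sum>k\<in>?P. multi_poly (CARD('n) * card S) (q k) x * f (\<chi> i. k i))" for x
    unfolding tensor_interpolant_def by (intro sum.cong) auto
  also have "\<dots> x = multi_poly (CARD('n) * card S) (\<lambda>\<beta>. \<Sum>k\<in>?P. q k \<beta> * f (\<chi> i. k i)) x" for x
    unfolding multi_poly_def sum_distrib_right by (subst sum.swap) (simp add: mult_ac)
  finally show ?thesis by blast
qed

subsection \<open>Whitney's inequality in several variables\<close>

lemma whitney_line:
  fixes f :: "'a::real_normed_vector \<Rightarrow> real"
  assumes f: "continuous_on UNIV f" and "1 \<le> r" "0 < \<eta>" "0 \<le> b"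
    and "diff_bounded r \<eta> \<rho> f M" "norm u = 1" "norm p + b + (real r)\<^sup>2 * \<eta> \<le> \<rho>"
  shows "\<exists>Q. degree Q < r \<and>
    (\<forall>t. \<bar>t\<bar> \<le> b \<longrightarrow> \<bar>f (p + t *\<^sub>R u) - poly Q t\<bar> \<le> whitney_const r \<eta> b * M)"
proof (rule whitney_real)
  show "continuous_on UNIV (\<lambda>t. f (p + t *\<^sub>R u))"
    by (intro continuous_on_compose2[OF f] continuous_intros) auto
  show "diff_bounded r \<eta> (b + (real r)\<^sup>2 * \<eta>) (\<lambda>t. f (p + t *\<^sub>R u)) M"
    using assms by (intro diff_bounded_line) (auto simp: add.assoc)
qed (use assms in auto)

lemma norm_le_card_mult:
  fixes x :: "real^'n::finite"
  assumes "\<And>i. \<bar>x $ i\<bar> \<le> b"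
  shows "norm x \<le> real CARD('n) * b"
  using norm_le_l1_cart[of x] sum_mono[of UNIV "\<lambda>i. \<bar>x $ i\<bar>" "\<lambda>_. b"] assms by auto

lemma multi_poly_approx_on_cube:
  fixes f :: "real^'n::finite \<Rightarrow> real"
  assumes f: "continuous_on UNIV f"
      "diff_bounded r \<eta> (real CARD('n) * b + b + (real r)\<^sup>2 * \<eta>) f M"
    and r: "1 \<le> r" and \<eta>: "0 < \<eta>" and "0 \<le> b"
    and S: "finite S" "S \<subseteq> {-b..b}" "card S = r"
    and B: "0 \<le> B" "\<And>t. \<bar>t\<bar> \<le> b \<Longrightarrow> (\<Sum>a\<in>S. \<bar>poly (lagrange_basis S a) t\<bar>) \<le> B"
  shows "\<exists>c. \<forall>x. (\<forall>i. \<bar>x $ i\<bar> \<le> b) \<longrightarrow> \<bar>f x - multi_poly (CARD('n) * r) c x\<bar>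
    \<le> (\<Sum>m<CARD('n). B ^ m) * ((1 + B) * (whitney_const r \<eta> b * M))"
proof -
  have coord_error: "\<bar>f x - (\<Sum>a\<in>S. poly (lagrange_basis S a) (x $ i) * f (coord_upd i a x))\<bar>
      \<le> (1 + B) * (whitney_const r \<eta> b * M)" if x: "\<And>j. \<bar>x $ j\<bar> \<le> b" for x i
  proof -
    have "norm (coord_upd i 0 x) \<le> real CARD('n) * b"
      using x \<open>0 \<le> b\<close> by (intro norm_le_card_mult) (simp add: coord_upd_nth)
    then obtain Q where Q: "degree Q < r"
        "\<And>t. \<bar>t\<bar> \<le> b \<Longrightarrow> \<bar>f (coord_upd i t x) - poly Q t\<bar> \<le> whitney_const r \<eta> b * M"
      using whitney_line[OF f(1) r \<eta> \<open>0 \<le> b\<close> f(2), of "axis i 1" "coord_upd i 0 x"]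
      unfolding coord_upd_eq_line[symmetric] by auto
    show ?thesis
      using lagrange_interpolation_error_le[where g = "\<lambda>t. f (coord_upd i t x)",
          OF S(2) _ Q(2) x[of i] B(2)[OF x[of i]]] Q(1) S(3)
      by (simp add: coord_upd_same)
  qed
  obtain c where "\<And>x. tensor_interpolant S UNIV f x = multi_poly (CARD('n) * r) c x"
    using tensor_interpolant_UNIV_eq_multi_poly[OF S(1), of f] S(3) by blast
  then show ?thesis
    using tensor_interpolant_error_le[OF S(2) B coord_error, of _ UNIV] by metis
qed

text \<open>Tensor interpolation produces total degrees up to \<open>n (r - 1)\<close>. On each line through the
  origin the interpolant is close to a polynomial of degree below \<open>r\<close>, so its homogeneous
  parts of degree at least \<open>r\<close> are of size \<open>M\<close> and may be dropped.\<close>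
lemma whitney_euclidean:
  assumes r: "1 \<le> r" and \<eta>: "0 < \<eta>" and b: "0 < b"
  shows "\<exists>C\<ge>0. \<exists>\<rho>\<ge>0. \<forall>(f :: real^'n::finite \<Rightarrow> real) M. continuous_on UNIV f \<longrightarrow>
    diff_bounded r \<eta> \<rho> f M \<longrightarrow> (\<exists>c. \<forall>x. norm x \<le> b \<longrightarrow> \<bar>f x - multi_poly r c x\<bar> \<le> C * M)"
proof -
  let ?N = "CARD('n) * r" and ?\<rho> = "real CARD('n) * b + b + (real r)\<^sup>2 * \<eta>"
  let ?W = "whitney_const r \<eta> b"
  obtain S where S: "finite S" "S \<subseteq> {-b..b}" "card S = r"
    using infinite_arbitrarily_large[of "{-b..b}" r] b by (auto simp: infinite_Icc_iff)
  obtain T where T: "T \<subseteq> {-b..b}" "card T = ?N"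
    using infinite_arbitrarily_large[of "{-b..b}" ?N] b by (auto simp: infinite_Icc_iff)
  obtain B where B: "0 \<le> B" "\<And>t. \<bar>t\<bar> \<le> b \<Longrightarrow> (\<Sum>a\<in>S. \<bar>poly (lagrange_basis S a) t\<bar>) \<le> B"
    using lebesgue_function_bounded[of b S] by blast
  define A where "A = (\<Sum>m<CARD('n). B ^ m) * ((1 + B) * ?W)"
  define D where "D = (\<Sum>d=r..<?N. b ^ d * (\<Sum>a\<in>T. \<bar>coeff (lagrange_basis T a) d\<bar>))"
  have "\<exists>c. \<forall>x. norm x \<le> b \<longrightarrow> \<bar>f x - multi_poly r c x\<bar> \<le> (A + D * (A + ?W)) * M"
    if f: "continuous_on UNIV f" "diff_bounded r \<eta> ?\<rho> f M" for f :: "real^'n \<Rightarrow> real" and M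
  proof -
    obtain c where "\<And>x. (\<And>i. \<bar>x $ i\<bar> \<le> b) \<Longrightarrow> \<bar>f x - multi_poly ?N c x\<bar> \<le> A * M"
      using multi_poly_approx_on_cube[OF f r \<eta> _ S B] b by (auto simp: A_def mult.assoc)
    then have approx: "\<bar>f x - multi_poly (card T) c x\<bar> \<le> A * M" if "norm x \<le> b" for x
      using that component_le_norm_cart order_trans unfolding T(2) by blast
    have "\<exists>Q. degree Q < r \<and> (\<forall>t. \<bar>t\<bar> \<le> b \<longrightarrow> \<bar>f (t *\<^sub>R u) - poly Q t\<bar> \<le> ?W * M)"
      if "norm u = 1" for u
      using whitney_line[OF f(1) r \<eta> _ f(2) that, of b 0] b by simp
    then have "\<bar>f x - multi_poly r c x\<bar> \<le> (A + D * (A + ?W)) * M" if "norm x \<le> b" for x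
      using multi_poly_truncation_error[OF T(1) _ approx _ that, of r "?W * M"] T(2)
      by (simp add: D_def algebra_simps)
    then show ?thesis by blast
  qed
  moreover have "0 \<le> ?W"
    using b \<eta> by (simp add: whitney_const_def)
  then have "0 \<le> A + D * (A + ?W)"
    using B(1) b unfolding A_def D_def
    by (intro add_nonneg_nonneg mult_nonneg_nonneg sum_nonneg) auto
  moreover have "0 \<le> ?\<rho>"
    using b \<eta> by simp
  ultimately show ?thesis by blast
qed

subsection \<open>Functions with vanishing moments\<close>

lemma Ck_imp_continuous: "Ck k f \<Longrightarrow> continuous_on UNIV f"
  by (cases k) auto

lemma continuous_on_monom: "continuous_on S (Defs.monom \<alpha>)"
  unfolding Defs.monom_def by (intro continuous_intros)

lemma continuous_on_multi_poly: "continuous_on S (multi_poly N c)"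
  unfolding multi_poly_def by (intro continuous_intros continuous_on_monom)

lemma compact_supp_imp_bounded:
  assumes "compact_supp g"
  shows "bounded {x. g x \<noteq> 0}"
  using assms closure_subset unfolding compact_supp_def
  by (metis bounded_subset compact_imp_bounded)

lemma integrable_mult_compact_supp:
  fixes g \<psi> :: "real^'n::finite \<Rightarrow> real"
  assumes "continuous_on UNIV g" "continuous_on UNIV \<psi>" "compact_supp \<psi>"
  shows "integrable lborel (\<lambda>x. g x * \<psi> x)"
proof -
  let ?K = "closure {x. \<psi> x \<noteq> 0}"
  have "integrable lborel (\<lambda>x. indicator ?K x *\<^sub>R (g x * \<psi> x))"
    using assms unfolding compact_supp_def
    by (intro borel_integrable_compact continuous_on_mult) (auto intro: continuous_on_subset)
  moreover have "indicator ?K x *\<^sub>R (g x * \<psi> x) = g x * \<psi> x" for x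
    using closure_subset[of "{x. \<psi> x \<noteq> 0}"] by (auto simp: indicator_def)
  ultimately show ?thesis by (simp only:)
qed

lemma LINT_vanishing_moments_bound:
  fixes \<psi> :: "real^'n::finite \<Rightarrow> real"
  assumes \<psi>: "continuous_on UNIV \<psi>" "compact_supp \<psi>" "\<And>x. \<psi> x \<noteq> 0 \<Longrightarrow> norm x \<le> b"
    and moments: "\<And>\<alpha>. sum \<alpha> UNIV < r \<Longrightarrow> (LINT x|lborel. Defs.monom \<alpha> x * \<psi> x) = 0"
    and g: "continuous_on UNIV g" "\<And>x. norm x \<le> b \<Longrightarrow> \<bar>g x - multi_poly r c x\<bar> \<le> K"
  shows "\<bar>LINT x|lborel. g x * \<psi> x\<bar> \<le> K * (LINT x|lborel. \<bar>\<psi> x\<bar>)"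
proof -
  note integrable = integrable_mult_compact_supp[OF _ \<psi>(1,2)]
  have "(LINT x|lborel. multi_poly r c x * \<psi> x)
      = (\<Sum>\<alpha> | sum \<alpha> UNIV < r. LINT x|lborel. c \<alpha> * (Defs.monom \<alpha> x * \<psi> x))"
    unfolding multi_poly_def sum_distrib_right mult.assoc
    by (intro Bochner_Integration.integral_sum integrable_mult_right integrable continuous_on_monom)
  also have "\<dots> = 0"
    by (intro sum.neutral) (auto simp: moments)
  finally have "(LINT x|lborel. g x * \<psi> x) = (LINT x|lborel. (g x - multi_poly r c x) * \<psi> x)"
    by (simp add: left_diff_distrib Bochner_Integration.integral_diff integrable g
        continuous_on_multi_poly)
  also have "\<bar>\<dots>\<bar> \<le> (LINT x|lborel. \<bar>(g x - multi_poly r c x) * \<psi> x\<bar>)"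
    by (rule integral_abs_bound)
  also have "\<dots> \<le> (LINT x|lborel. K * \<bar>\<psi> x\<bar>)"
  proof (rule integral_mono)
    show "integrable lborel (\<lambda>x. \<bar>(g x - multi_poly r c x) * \<psi> x\<bar>)"
      by (intro integrable_abs integrable continuous_intros g continuous_on_multi_poly)
    show "integrable lborel (\<lambda>x. K * \<bar>\<psi> x\<bar>)"
      using integrable_abs[OF integrable[of "\<lambda>_. K"]] integrable[of "\<lambda>_. 1"]
      by (intro integrable_mult_right integrable_abs) simp
    show "\<bar>(g x - multi_poly r c x) * \<psi> x\<bar> \<le> K * \<bar>\<psi> x\<bar>" for x
      using g(2)[of x] \<psi>(3)[of x] by (cases "\<psi> x = 0") (auto simp: abs_mult intro!: mult_right_mono)
  qed
  finally show ?thesis by simp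
qed

definition diff_dominated :: "nat \<Rightarrow> real \<Rightarrow> real \<Rightarrow> real \<Rightarrow> (real^'n::finite \<Rightarrow> real) \<Rightarrow> bool" where
  "diff_dominated r \<eta> \<rho> C \<psi> \<longleftrightarrow> (\<forall>g M. continuous_on UNIV g \<longrightarrow> diff_bounded r \<eta> \<rho> g M \<longrightarrow>
     \<bar>LINT x|lborel. g x * \<psi> x\<bar> \<le> C * M)"

lemma daubechies_imp_diff_dominated:
  fixes \<phi> :: "real^'n::finite \<Rightarrow> real"
  assumes daubechies: "daubechies L \<phi> \<psi>" and r: "1 \<le> r" "r \<le> L + 1" and \<eta>: "0 < \<eta>"
  shows "\<exists>C>1. \<exists>\<rho>. \<forall>l\<in>{1..<2 ^ CARD('n)}. diff_dominated r \<eta> \<rho> C (\<psi> l)"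
proof -
  let ?I = "{1..<(2::nat) ^ CARD('n)}"
  have \<psi>: "continuous_on UNIV (\<psi> l)" "compact_supp (\<psi> l)"
    "\<And>\<alpha>. sum \<alpha> UNIV < r \<Longrightarrow> (LINT x|lborel. Defs.monom \<alpha> x * \<psi> l x) = 0" if "l \<in> ?I" for l
    using daubechies that r(2) by (auto simp: daubechies_def intro: Ck_imp_continuous)
  have "bounded (\<Union>l\<in>?I. {x. \<psi> l x \<noteq> 0})"
    using \<psi>(2) by (intro bounded_UN) (auto intro: compact_supp_imp_bounded)
  then obtain b where b: "0 < b" "\<And>l x. l \<in> ?I \<Longrightarrow> \<psi> l x \<noteq> 0 \<Longrightarrow> norm x \<le> b"
    by (force simp: bounded_pos)
  obtain C \<rho> where C: "0 \<le> C" and \<rho>: "0 \<le> \<rho>" and whitney: "\<And>(g :: real^'n \<Rightarrow> real) M.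
      continuous_on UNIV g \<Longrightarrow> diff_bounded r \<eta> \<rho> g M \<Longrightarrow>
      \<exists>c. \<forall>x. norm x \<le> b \<longrightarrow> \<bar>g x - multi_poly r c x\<bar> \<le> C * M"
    using whitney_euclidean[OF r(1) \<eta> b(1)] by blast
  define J where "J = (\<Sum>l\<in>?I. LINT x|lborel. \<bar>\<psi> l x\<bar>)"
  have "\<bar>LINT x|lborel. g x * \<psi> l x\<bar> \<le> (C * J + 2) * M"
    if g: "continuous_on UNIV g" "diff_bounded r \<eta> \<rho> g M" and l: "l \<in> ?I" for g M l
  proof -
    have "0 \<le> M"
      using diff_bounded_nonneg[OF g(2)] r(1) \<eta> \<rho> by simp
    obtain c where "\<And>x. norm x \<le> b \<Longrightarrow> \<bar>g x - multi_poly r c x\<bar> \<le> C * M"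
      using whitney[OF g] by blast
    then have "\<bar>LINT x|lborel. g x * \<psi> l x\<bar> \<le> C * M * (LINT x|lborel. \<bar>\<psi> l x\<bar>)"
      by (intro LINT_vanishing_moments_bound[OF \<psi>(1,2)[OF l] b(2)[OF l] \<psi>(3)[OF l] g(1)])
    also have "\<dots> \<le> C * M * J"
      unfolding J_def using C l \<open>0 \<le> M\<close> by (intro mult_left_mono member_le_sum) auto
    also have "\<dots> \<le> (C * J + 2) * M"
      using \<open>0 \<le> M\<close> by (simp add: algebra_simps)
    finally show ?thesis .
  qed
  moreover have "0 \<le> C * J"
    using C by (simp add: J_def sum_nonneg)
  then have "C * J + 2 > 1" by simp
  ultimately show ?thesis
    unfolding diff_dominated_def by blast
qed

subsection \<open>Wavelet coefficients and dyadic cubes\<close>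

lemma LINT_lborel_affine:
  fixes f :: "'a::euclidean_space \<Rightarrow> 'b::{banach, second_countable_topology}"
  assumes [measurable]: "f \<in> borel_measurable borel" and "c \<noteq> 0"
  shows "(LINT x|lborel. f x) = \<bar>c\<bar> ^ DIM('a) *\<^sub>R (LINT x|lborel. f (t + c *\<^sub>R x))"
proof -
  have "(LINT x|lborel. f x)
      = (LINT x|density (distr lborel borel (\<lambda>x. t + c *\<^sub>R x)) (\<lambda>_. ennreal (\<bar>c\<bar> ^ DIM('a))). f x)"
    using lborel_affine[OF \<open>c \<noteq> 0\<close>, of t] by simp
  also have "\<dots> = (LINT x|distr lborel borel (\<lambda>x. t + c *\<^sub>R x). \<bar>c\<bar> ^ DIM('a) *\<^sub>R f x)"
    by (subst integral_density) auto
  also have "\<dots> = (LINT x|lborel. \<bar>c\<bar> ^ DIM('a) *\<^sub>R f (t + c *\<^sub>R x))"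
    by (subst integral_distr) auto
  finally show ?thesis by simp
qed

definition dyadic_corner :: "int \<Rightarrow> ('n::finite \<Rightarrow> int) \<Rightarrow> real^'n" where
  "dyadic_corner j k = 2 powr (- real_of_int j) *\<^sub>R (\<chi> i. of_int (k i))"

lemma LINT_mult_wav:
  fixes f g :: "real^'n::finite \<Rightarrow> real"
  assumes "continuous_on UNIV f" "continuous_on UNIV g"
  shows "(LINT x|lborel. f x * wav g j k x) = 2 powr (- real_of_int j * real CARD('n) / 2) *
    (LINT z|lborel. f (dyadic_corner j k + 2 powr (- real_of_int j) *\<^sub>R z) * g z)"
proof -
  let ?a = "2 powr (- real_of_int j)" and ?n = "real CARD('n)"
  have integrand: "f u * wav g j k (dyadic_corner j k + ?a *\<^sub>R z)
      = 2 powr (real_of_int j * ?n / 2) * (f u * g z)" for u z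
    by (simp add: wav_def dyadic_corner_def scaleR_right_distrib powr_minus)
  have "continuous_on UNIV (\<lambda>x. f x * wav g j k x)"
    unfolding wav_def
    by (intro continuous_intros assms continuous_on_compose2[OF assms(2)]) auto
  then have "(LINT x|lborel. f x * wav g j k x) = ?a ^ CARD('n) *
      (LINT z|lborel. f (dyadic_corner j k + ?a *\<^sub>R z) * wav g j k (dyadic_corner j k + ?a *\<^sub>R z))"
    using LINT_lborel_affine[of "\<lambda>x. f x * wav g j k x" ?a "dyadic_corner j k"]
    by (simp add: borel_measurable_continuous_onI)
  also have "\<dots> = (?a ^ CARD('n) * 2 powr (real_of_int j * ?n / 2)) *
      (LINT z|lborel. f (dyadic_corner j k + ?a *\<^sub>R z) * g z)"
    by (simp only: integrand integral_mult_right_zero mult.assoc)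
  also have "?a ^ CARD('n) * 2 powr (real_of_int j * ?n / 2) = 2 powr (- real_of_int j * ?n / 2)"
    by (simp add: powr_powr powr_add[symmetric] flip: powr_realpow)
  finally show ?thesis .
qed

lemma measure_dcube:
  "measure lborel (dcube j k :: (real^'n::finite) set) = 2 powr (- real_of_int j * real CARD('n))"
proof -
  define a where "a = 2 powr (- real_of_int j)"
  define l u :: "real^'n"
    where "l = (\<chi> i. a * of_int (k i))" and "u = (\<chi> i. a * (of_int (k i) + 1))"
  have "0 < a" by (simp add: a_def)
  have edge: "(u - l) \<bullet> e = a" if "e \<in> Basis" for e
    using that by (auto simp: Basis_vec_def l_def u_def inner_axis algebra_simps)
  have l_le_u: "l \<bullet> e \<le> u \<bullet> e" if "e \<in> Basis" for e
    using edge[OF that] \<open>0 < a\<close> by (simp add: inner_diff_left)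
  have "dcube j k \<in> sets (lborel :: (real^'n) measure)"
    unfolding dcube_def by measurable
  moreover have "box l u \<subseteq> dcube j k" "dcube j k \<subseteq> cbox l u"
    by (auto simp: dcube_def l_def u_def a_def mem_box_cart less_imp_le)
  ultimately have "emeasure lborel (dcube j k :: (real^'n) set) = ennreal (a ^ CARD('n))"
    using emeasure_mono[of "box l u" "dcube j k" lborel]
      emeasure_mono[of "dcube j k" "cbox l u" lborel]
    by (simp add: l_le_u edge antisym)
  then show ?thesis
    by (simp add: measure_def a_def powr_powr flip: powr_realpow)
qed

lemma measure_dcube_powr:
  "measure lborel (dcube j k :: (real^'n::finite) set) powr (s / real CARD('n) + 1/2)
    = 2 powr (- real_of_int j * real CARD('n) / 2) * (2 powr (- real_of_int j)) powr s"
proof -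
  have "- real_of_int j * real CARD('n) * (s / real CARD('n) + 1/2)
      = - real_of_int j * real CARD('n) / 2 + - real_of_int j * s"
    by (simp add: distrib_left)
  then show ?thesis
    unfolding measure_dcube powr_powr powr_add[symmetric] by simp
qed

lemma norm_diff_dyadic_corner_le:
  fixes x :: "real^'n::finite"
  assumes "x \<in> dcube j k"
  shows "norm (x - dyadic_corner j k) \<le> real CARD('n) * 2 powr (- real_of_int j)"
proof (rule norm_le_card_mult)
  show "\<bar>(x - dyadic_corner j k) $ i\<bar> \<le> 2 powr (- real_of_int j)" for i
    using assms by (auto simp: dcube_def dyadic_corner_def algebra_simps dest!: spec[of _ i])
qed

subsection \<open>Large coefficients force large differences\<close>

lemma DeltaPow_Delta1:
  "DeltaPow r h (Delta1 h f) x
    = DeltaPow r h f (x + (1/2) *\<^sub>R h) - DeltaPow r h f (x - (1/2) *\<^sub>R h)"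
  by (induction r arbitrary: f x) (auto simp: Delta1_def)

lemma forward_diff_eq_DeltaPow:
  "forward_diff r f h x = DeltaPow r h f (x + (real r / 2) *\<^sub>R h)"
proof (induction r arbitrary: x)
  case (Suc r)
  have "x + (real (Suc r) / 2) *\<^sub>R h - (1/2) *\<^sub>R h = x + (real r / 2) *\<^sub>R h"
    "x + (real (Suc r) / 2) *\<^sub>R h + (1/2) *\<^sub>R h = x + h + (real r / 2) *\<^sub>R h"
    by (auto simp: vec_eq_iff field_simps)
  then show ?case
    by (simp only: forward_diff.simps DeltaPow.simps DeltaPow_Delta1 Suc.IH)
qed simp

lemma abs_forward_diff_le_DeltaR:
  assumes "bounded (range f)"
  shows "\<bar>forward_diff r f h x\<bar> \<le> DeltaR r f (x + (real r / 2) *\<^sub>R h) (norm h)"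
proof -
  obtain B where "\<And>x. norm (f x) \<le> B"
    using assms by (auto simp: bounded_iff)
  then have "\<bar>DeltaPow r h' f y\<bar> \<le> 2 ^ r * B" for h' y
    using norm_forward_diff_le[of f B r h' "y - (real r / 2) *\<^sub>R h'"]
    by (simp add: forward_diff_eq_DeltaPow)
  then have "bdd_above ((\<lambda>h'. \<bar>DeltaPow r h' f y\<bar>) ` {h'. norm h' = norm h})" for y
    by (intro bdd_aboveI2)
  then show ?thesis
    unfolding forward_diff_eq_DeltaPow DeltaR_def by (auto intro!: cSUP_upper2)
qed

lemma diff_bounded_rescale:
  fixes f :: "real^'n \<Rightarrow> real"
  assumes "bounded (range f)" and a: "0 < a"
    and DeltaR_le: "\<And>x y. norm (x - p) \<le> a * (\<rho> + (real r)\<^sup>2 * \<eta>) \<Longrightarrow> a * \<eta> \<le> y \<Longrightarrow>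
      y \<le> a * (2 * real r * \<eta>) \<Longrightarrow> DeltaR r f x y \<le> M"
  shows "diff_bounded r \<eta> \<rho> (\<lambda>z. f (p + a *\<^sub>R z)) M"
  unfolding diff_bounded_def
proof (intro allI impI)
  fix z v :: "real^'n"
  assume z: "norm z \<le> \<rho>" and v: "\<eta> \<le> norm v" "norm v \<le> 2 * real r * \<eta>"
  have "forward_diff r (\<lambda>z. f (p + a *\<^sub>R z)) v z = forward_diff r f (a *\<^sub>R v) (p + a *\<^sub>R z)"
    by (rule forward_diff_linear_comp) (simp add: linear_iff scaleR_add_right)
  also have "\<bar>\<dots>\<bar> \<le> DeltaR r f (p + a *\<^sub>R z + (real r / 2) *\<^sub>R (a *\<^sub>R v)) (norm (a *\<^sub>R v))"
    by (rule abs_forward_diff_le_DeltaR[OF assms(1)])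
  also have "\<dots> \<le> M"
  proof (rule DeltaR_le)
    have "p + a *\<^sub>R z + (real r / 2) *\<^sub>R (a *\<^sub>R v) - p = a *\<^sub>R (z + (real r / 2) *\<^sub>R v)"
      by (simp add: algebra_simps)
    moreover have "real r / 2 * norm v \<le> real r / 2 * (2 * real r * \<eta>)"
      using v by (intro mult_left_mono) auto
    with z have "norm (z + (real r / 2) *\<^sub>R v) \<le> \<rho> + real r / 2 * (2 * real r * \<eta>)"
      by (intro norm_triangle_le) simp
    ultimately show "norm (p + a *\<^sub>R z + (real r / 2) *\<^sub>R (a *\<^sub>R v) - p) \<le> a * (\<rho> + (real r)\<^sup>2 * \<eta>)"
      using a by (simp add: power2_eq_square mult.assoc)
    show "a * \<eta> \<le> norm (a *\<^sub>R v)" "norm (a *\<^sub>R v) \<le> a * (2 * real r * \<eta>)"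
      using v a by (simp_all add: mult_left_mono)
  qed
  finally show "\<bar>forward_diff r (\<lambda>z. f (p + a *\<^sub>R z)) v z\<bar> \<le> M" .
qed

lemma large_coefficient_imp_large_DeltaR:
  fixes f :: "real^'n::finite \<Rightarrow> real"
  assumes f: "continuous_on UNIV f" "bounded (range f)" and "0 < C"
    and \<psi>: "\<And>l. l \<in> {1..<2 ^ CARD('n)} \<Longrightarrow> continuous_on UNIV (\<psi> l)"
    and dominated: "\<And>l. l \<in> {1..<2 ^ CARD('n)} \<Longrightarrow> diff_dominated r \<eta> \<rho> C (\<psi> l)"
    and k: "k \<in> W_set j s \<psi> f \<epsilon>"
  shows "\<exists>x y. norm (x - dyadic_corner j k) \<le> 2 powr (- real_of_int j) * (\<rho> + (real r)\<^sup>2 * \<eta>) \<and>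
    2 powr (- real_of_int j) * \<eta> \<le> y \<and> y \<le> 2 powr (- real_of_int j) * (2 * real r * \<eta>) \<and>
    \<epsilon> / C * (2 powr (- real_of_int j)) powr s < DeltaR r f x y"
proof (rule ccontr)
  assume no_large_DeltaR: "\<not> ?thesis"
  define a where "a = 2 powr (- real_of_int j)"
  define V where "V = 2 powr (- real_of_int j * real CARD('n) / 2)"
  define g where "g z = f (dyadic_corner j k + a *\<^sub>R z)" for z
  have "continuous_on UNIV g"
    unfolding g_def by (intro continuous_on_compose2[OF f(1)] continuous_intros) auto
  moreover have "diff_bounded r \<eta> \<rho> g (\<epsilon> / C * a powr s)"
    unfolding g_def using no_large_DeltaR
    by (intro diff_bounded_rescale f(2)) (auto simp: a_def not_less)
  ultimately have "\<bar>LINT z|lborel. g z * \<psi> l z\<bar> \<le> \<epsilon> * a powr s" if "l \<in> {1..<2 ^ CARD('n)}" for l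
    using dominated[OF that] \<open>0 < C\<close> unfolding diff_dominated_def by fastforce
  then have "V * \<bar>LINT z|lborel. g z * \<psi> l z\<bar> \<le> V * (\<epsilon> * a powr s)"
    if "l \<in> {1..<2 ^ CARD('n)}" for l
    using that by (intro mult_left_mono) (simp_all add: V_def)
  then have coefficients_small:
    "\<bar>LINT x|lborel. f x * wav (\<psi> l) j k x\<bar> \<le> \<epsilon> * (V * a powr s)"
    if "l \<in> {1..<2 ^ CARD('n)}" for l
    using that by (simp add: LINT_mult_wav f(1) \<psi> abs_mult g_def a_def V_def mult_ac)
  have "(2::nat) ^ 1 \<le> 2 ^ CARD('n)"
    by (intro power_increasing) auto
  then have "{1..<(2::nat) ^ CARD('n)} \<noteq> {}" by simp
  moreover have "\<epsilon> * (V * a powr s)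
      < (MAX l\<in>{1..<2 ^ CARD('n)}. \<bar>LINT x|lborel. f x * wav (\<psi> l) j k x\<bar>)"
    using k by (simp add: W_set_def measure_dcube_powr V_def a_def)
  ultimately obtain l where "l \<in> {1..<2 ^ CARD('n)}"
      "\<epsilon> * (V * a powr s) < \<bar>LINT x|lborel. f x * wav (\<psi> l) j k x\<bar>"
    by (subst (asm) Max_gr_iff) auto
  with coefficients_small[of l] show False by simp
qed

subsection \<open>Comparison in the hyperbolic half space\<close>

lemma dyadic_scale:
  fixes y :: real
  assumes "2 powr (- real n - 1) < y" "y \<le> 2 powr (- real m)"
  shows "\<exists>i\<in>{m..n}. 2 powr (- real i - 1) < y \<and> y \<le> 2 powr (- real i)"
proof -
  define i where "i = nat \<lfloor>- log 2 y\<rfloor>"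
  have "0 < y"
    using less_trans[OF _ assms(1), of 0] by simp
  with assms have "log 2 y \<le> - real m" "- real n - 1 < log 2 y"
    by (simp_all add: log_le_iff less_log_iff)
  then have "log 2 y \<le> - real i" "- real i - 1 < log 2 y" and i: "i \<in> {m..n}"
    unfolding i_def atLeastAtMost_iff by linarith+
  with \<open>0 < y\<close> have "2 powr (- real i - 1) < y" "y \<le> 2 powr (- real i)"
    by (simp_all add: log_le_iff less_log_iff)
  with i show ?thesis by blast
qed

lemma mem_S_set_dyadic:
  assumes "\<delta> * y powr s < DeltaR r f x y" "2 powr (- real n - 1) < y" "y \<le> 2 powr (- real m)"
  shows "\<exists>i\<in>{m..n}. (x, y) \<in> S_set r (int i) s f \<delta>"
proof -
  have "0 < y"
    using less_trans[OF _ assms(2), of 0] by simp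
  with assms(1) have "\<delta> < DeltaR r f x y / y powr s"
    by (simp add: pos_less_divide_eq)
  with \<open>0 < y\<close> dyadic_scale[OF assms(2,3)] show ?thesis
    by (auto simp: S_set_def)
qed

lemma hyp_dist_le_arcosh:
  assumes "0 < a" "norm (x - x') \<le> a * q" "a / 2 < y" "y \<le> a" "a * \<delta> \<le> y'" "y' \<le> a" "0 < \<delta>"
  shows "hyp_dist (x, y) (x', y') \<le> arcosh (1 + (q\<^sup>2 + 1) / \<delta>)"
proof -
  have "0 < a * \<delta>" using assms by simp
  then have pos: "0 < y" "0 < y'" using assms by linarith+
  have "(norm (x - x'))\<^sup>2 \<le> (a * q)\<^sup>2"
    using assms by (intro power_mono) auto
  moreover have "(y - y')\<^sup>2 \<le> a\<^sup>2"
    using assms pos by (intro abs_le_square_iff[THEN iffD1]) auto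
  ultimately have "(norm (x - x'))\<^sup>2 + (y - y')\<^sup>2 \<le> a\<^sup>2 * (q\<^sup>2 + 1)"
    by (simp add: algebra_simps power_mult_distrib)
  moreover have "a * (a * \<delta>) \<le> (2 * y) * y'"
    using assms pos by (intro mult_mono) auto
  then have "a\<^sup>2 * \<delta> \<le> 2 * y * y'"
    by (simp add: power2_eq_square mult_ac)
  ultimately have "((norm (x - x'))\<^sup>2 + (y - y')\<^sup>2) / (2 * y * y') \<le> (a\<^sup>2 * (q\<^sup>2 + 1)) / (a\<^sup>2 * \<delta>)"
    using assms by (intro frac_le) auto
  also have "\<dots> = (q\<^sup>2 + 1) / \<delta>"
    using assms by simp
  finally have "1 + ((norm (x - x'))\<^sup>2 + (y - y')\<^sup>2) / (2 * y * y') \<le> 1 + (q\<^sup>2 + 1) / \<delta>"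
    by simp
  moreover have "0 \<le> ((norm (x - x'))\<^sup>2 + (y - y')\<^sup>2) / (2 * y * y')"
    using pos by simp
  ultimately show ?thesis
    unfolding hyp_dist_def fst_conv snd_conv
    by (subst linorder_not_less[symmetric], subst arcosh_less_iff_real) auto
qed

lemma Tbox_imp_mem_hyp_nbhd_S_set:
  fixes x :: "real^'n::finite"
  assumes p: "p \<in> Tbox (int j) k"
    and x: "norm (x - dyadic_corner (int j) k) \<le> 2 powr (- real j) * q"
    and y: "2 powr (- real j) * \<eta> \<le> y" "y \<le> 2 powr (- real j) / 2"
    and large: "\<delta> * (2 powr (- real j)) powr s < DeltaR r f x y"
    and "0 \<le> s" "0 \<le> \<delta>" and m: "2 powr (- real m - 1) < \<eta>"
    and R: "arcosh (1 + ((real CARD('n) + q)\<^sup>2 + 1) / \<eta>) < R"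
  shows "\<exists>i\<in>{j+1..j+m}. p \<in> hyp_nbhd (S_set r (int i) s f \<delta>) R"
proof -
  define a where "a = 2 powr (- real j)"
  have "0 < a" by (simp add: a_def)
  have "0 < \<eta>" using less_trans[OF _ m, of 0] by simp
  have lower: "2 powr (- real (j + m) - 1) < y"
    using mult_strict_left_mono[OF m \<open>0 < a\<close>] y(1)
    by (simp add: a_def powr_add[symmetric] algebra_simps)
  have upper: "y \<le> 2 powr (- real (j + 1))"
    using y(2) unfolding powr_minus by (simp add: powr_add)
  have "\<delta> * y powr s \<le> \<delta> * a powr s"
    using y(2) \<open>0 \<le> s\<close> \<open>0 \<le> \<delta>\<close> less_trans[OF _ lower, of 0]
    by (intro mult_left_mono powr_mono2) (auto simp: a_def)
  then have "\<delta> * y powr s < DeltaR r f x y"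
    using large by (simp add: a_def)
  then obtain i where i: "i \<in> {j+1..j+m}" "(x, y) \<in> S_set r (int i) s f \<delta>"
    using mem_S_set_dyadic[OF _ lower upper] by blast
  obtain x0 y0 where p_eq: "p = (x0, y0)" and x0: "x0 \<in> dcube (int j) k"
    and y0: "a / 2 < y0" "y0 \<le> a"
    using p by (auto simp: Tbox_def a_def)
  have "norm (x0 - x) \<le> a * (real CARD('n) + q)"
    using norm_diff_dyadic_corner_le[OF x0] x
      norm_triangle_ineq4[of "x0 - dyadic_corner (int j) k" "x - dyadic_corner (int j) k"]
    by (simp add: a_def algebra_simps)
  then have "hyp_dist p (x, y) \<le> arcosh (1 + ((real CARD('n) + q)\<^sup>2 + 1) / \<eta>)"
    unfolding p_eq using y \<open>0 < a\<close> \<open>0 < \<eta>\<close> y0 by (intro hyp_dist_le_arcosh) (auto simp: a_def)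
  moreover have "0 < snd p"
    using y0 \<open>0 < a\<close> by (simp add: p_eq)
  ultimately show ?thesis
    using i R by (force simp: hyp_nbhd_def)
qed

lemma T_set_subset_hyp_nbhd_S_set:
  fixes f :: "real^'n::finite \<Rightarrow> real"
  assumes f: "continuous_on UNIV f" "bounded (range f)" and "0 \<le> s" "0 < \<epsilon>" "0 < C"
    and \<psi>: "\<And>l. l \<in> {1..<2 ^ CARD('n)} \<Longrightarrow> continuous_on UNIV (\<psi> l)"
      "\<And>l. l \<in> {1..<2 ^ CARD('n)} \<Longrightarrow> diff_dominated r \<eta> \<rho> C (\<psi> l)"
    and \<eta>: "2 * real r * \<eta> = 1 / 2" and m: "2 powr (- real m - 1) < \<eta>"
    and R: "arcosh (1 + ((real CARD('n) + (\<rho> + (real r)\<^sup>2 * \<eta>))\<^sup>2 + 1) / \<eta>) < R"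
  shows "T_set (int j) s \<psi> f \<epsilon>
    \<subseteq> (\<Union>i\<in>{j+1..j+m}. hyp_nbhd (S_set r (int i) s f (\<epsilon> / C)) R)"
proof
  fix p assume "p \<in> T_set (int j) s \<psi> f \<epsilon>"
  then obtain k where k: "k \<in> W_set (int j) s \<psi> f \<epsilon>" and p: "p \<in> Tbox (int j) k"
    by (auto simp: T_set_def)
  obtain x y where
      "norm (x - dyadic_corner (int j) k) \<le> 2 powr (- real j) * (\<rho> + (real r)\<^sup>2 * \<eta>)"
      "2 powr (- real j) * \<eta> \<le> y" "y \<le> 2 powr (- real j) * (2 * real r * \<eta>)"
      "\<epsilon> / C * (2 powr (- real j)) powr s < DeltaR r f x y"
    using large_coefficient_imp_large_DeltaR[OF f \<open>0 < C\<close> \<psi> k] by auto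
  then show "p \<in> (\<Union>i\<in>{j+1..j+m}. hyp_nbhd (S_set r (int i) s f (\<epsilon> / C)) R)"
    using Tbox_imp_mem_hyp_nbhd_S_set[OF p _ _ _ _ \<open>0 \<le> s\<close> _ m R] \<eta> \<open>0 < \<epsilon>\<close> \<open>0 < C\<close> by simp
qed

theorem mainTheorem9:
  fixes s :: real and r L :: nat
    and \<phi> :: "real^'n::finite \<Rightarrow> real" and \<psi> :: "nat \<Rightarrow> real^'n \<Rightarrow> real"
  assumes "0 < s" and "1 \<le> r" and "real r > s"
    and "daubechies L \<phi> \<psi>" and "L + 1 \<ge> r"
  shows "\<exists>c m R. 0 < c \<and> c < 1 \<and> 1 \<le> m \<and> 1 < R \<and>
     (\<forall>f \<in> Lambda s. \<forall>\<epsilon> > 0. \<forall>j::nat.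
        T_set (int j) s \<psi> f \<epsilon>
          \<subseteq> (\<Union>i\<in>{j+1..j+m}. hyp_nbhd (S_set r (int i) s f (c * \<epsilon>)) R))"
proof -
  define \<eta> where "\<eta> = 1 / (4 * real r)"
  have \<eta>: "0 < \<eta>" "2 * real r * \<eta> = 1 / 2"
    using assms(2) by (auto simp: \<eta>_def)
  obtain C \<rho> where C: "C > 1"
      and dominated: "\<And>l. l \<in> {1..<2 ^ CARD('n)} \<Longrightarrow> diff_dominated r \<eta> \<rho> C (\<psi> l)"
    using daubechies_imp_diff_dominated[OF assms(4,2,5) \<eta>(1)] by blast
  have continuous: "continuous_on UNIV (\<psi> l)" if "l \<in> {1..<2 ^ CARD('n)}" for l
    using assms(4) that by (auto simp: daubechies_def intro: Ck_imp_continuous)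
  obtain m where "- log 2 \<eta> < real m"
    using reals_Archimedean2 by blast
  then have m: "2 powr (- real (Suc m) - 1) < \<eta>"
    using \<eta>(1) by (simp flip: less_log_iff)
  define Q where "Q = ((real CARD('n) + (\<rho> + (real r)\<^sup>2 * \<eta>))\<^sup>2 + 1) / \<eta>"
  have "0 \<le> arcosh (1 + Q)"
    using \<eta>(1) by (intro arcosh_nonneg_real) (simp add: Q_def)
  moreover have "T_set (int j) s \<psi> f \<epsilon>
      \<subseteq> (\<Union>i\<in>{j+1..j+Suc m}. hyp_nbhd (S_set r (int i) s f (\<epsilon> / C)) (arcosh (1 + Q) + 2))"
    if "f \<in> Lambda s" "0 < \<epsilon>" for f \<epsilon> j
    using that C assms(1) unfolding Lambda_def
    by (intro T_set_subset_hyp_nbhd_S_set[OF _ _ _ _ _ continuous dominated \<eta>(2) m])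
      (auto simp: Q_def)
  ultimately show ?thesis
    using C by (intro exI[of _ "1 / C"] exI[of _ "Suc m"] exI[of _ "arcosh (1 + Q) + 2"]) auto
qed

end
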